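(* Let $n\ge 3$. (i) Let $f:S^{n-1}\to\mathbb{R}$ be a continuous function. Assume that for every two-dimensional linear subspace $P\subset\mathbb{R}^n$ there exist an integer $q=q(P)\ge 4$ (which may depend on $P$), a rotation $\varphi_q\in SO(P,2)$ of $P$ by the angle $\frac{2\pi}{q}$, and a vector $b=b_P\in P$ such that $$f(\varphi_q(x))+\langle b,x\rangle=f(x)\qquad\text{for all } x\in S^{n-1}\cap P.$$ Then there exist a constant $c\in\mathbb{R}$ and a vector $a\in\mathbb{R}^n$ such that $f(x)=c+\langle a,x\rangle$ for all $x\in S^{n-1}$. (ii) On the other hand, for $q=3$, the function $f(x)=x_1x_2x_3$, $x\in S^{n-1}$, satisfies the following condition: for every two-dimensional linear subspace $P\subset\mathbb{R}^n$ there exist a rotation $\varphi_3\in SO(P,2)$ by the angle $\frac{2\pi}{3}$ and a vector $b\in P$ such that $f(\varphi_3(x))+\langle b,x\rangle=f(x)$ for all $x\in S^{n-1}\cap P$.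
   Context: $S^{n-1}$ is the Euclidean unit sphere in $\mathbb{R}^n$, $\langle\cdot,\cdot\rangle$ is the standard scalar product, and $x_1,\dots,x_n$ are the coordinates of $x$ in a fixed orthonormal basis. For a two-dimensional subspace $P$, $SO(P,2)$ is the group of rotations of $P$. *)

theory Defs
  imports "HOL-Analysis.Analysis"
begin

(* SO(P,2) for a plane P consists of the maps \<phi> with rotation_of_plane P \<theta> \<phi> for some \<theta>.
   Since P carries no preferred orientation, the sense of the rotation is that of some orthonormal
   basis (u, v) of P. A map of P is represented by a total function whose values outside P are
   irrelevant. *)
definition rotation_of_plane ::
    "'a::euclidean_space set \<Rightarrow> real \<Rightarrow> ('a \<Rightarrow> 'a) \<Rightarrow> bool" where
  "rotation_of_plane P \<theta> \<phi> \<longleftrightarrow>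
     (\<exists>u v. norm u = 1 \<and> norm v = 1 \<and> u \<bullet> v = 0 \<and> span {u, v} = P \<and>
        (\<forall>s t. \<phi> (s *\<^sub>R u + t *\<^sub>R v) =
           (cos \<theta> * s - sin \<theta> * t) *\<^sub>R u + (sin \<theta> * s + cos \<theta> * t) *\<^sub>R v))"

(* Only the values e 1, ..., e n matter, so that the coordinates of x are e 1 \<bullet> x, ..., e n \<bullet> x. *)
definition orthonormal_basis :: "(nat \<Rightarrow> real ^ 'n) \<Rightarrow> bool" where
  "orthonormal_basis e \<longleftrightarrow>
     (\<forall>i\<in>{1..CARD('n)}. \<forall>j\<in>{1..CARD('n)}. e i \<bullet> e j = (if i = j then 1 else 0)) \<and>
     span (e ` {1..CARD('n)}) = UNIV"

end

theory Submission
  imports Defs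
begin

text \<open>Restrict f to a great circle, parametrised by its angle t. The hypothesis says that shifting t by
2 pi / q changes f only by a trigonometric polynomial of pure frequency 1, so a Fourier coefficient
of frequency k other than 0 and 1 can be nonzero only if q divides k. The integer q depends on the
circle, but since q is at least 4 it never divides 2 or 3: the coefficients of frequency 2 and 3 of
f vanish on \<^emph>\<open>every\<close> great circle (great_circle_Fourier_coeff_eq_0). In terms of
spherical harmonics this suffices, because a harmonic space of even degree at least 2 contains frequency 2 on some great circle and one of odd degree at
least 3 contains frequency 3; the argument below reaches the conclusion without harmonics, by
averaging.

Fix a point p of a two-dimensional sphere and average f over the rotations about p. The result
depends only on the height z, the inner product with p; write g z for it. A great circle whose
highest point has height s passes through the heights s cos t, so g satisfies

  integral of g (s cos t) cos (k t) over a full period = 0   for all s in [0, 1] and k = 2, 3.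

These Abel-type integral equations force g to be affine: integrating over s with the density that
turns the family of circles into a sphere leaves an integral of g against a polynomial, and letting
the radius of the sphere vary gives an ordinary differential equation for a primitive
(even_part_eq_power_if_circle_integral_0). Hence the average of f at
height z about p is (f p + f (-p)) / 2 + z (f p - f (-p)) / 2 (latitude_integral_affine).

In three-dimensional space integrate now the product of f (x / |x|), a radial weight and one of the
functions 1 and (p, x) over the whole space. Lebesgue measure is invariant under rotations about p, so f may be
replaced by its average. The first integral shows that f p + f (-p) does not depend on p, the
second that f p - f (-p) is linear in p. So f is affine on every two-dimensional sphere
(affine_on_sphere_real3), in particular on every great circle, and since any two points lie on a
common great circle these affine functions fit together (affine_if_affine_on_great_circles).

For q = 3 the frequency 3 survives a rotation by 2 pi / 3, and a cubic form restricted to the unit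
circle has only the frequencies 1 and 3.\<close>

section \<open>Fourier coefficients on great circles\<close>

lemma integral_periodic_shift:
  fixes g :: "real \<Rightarrow> real"
  assumes cont: "continuous_on UNIV g" and per: "\<And>t. g (t + 2*pi) = g t"
    and a: "0 \<le> a" "a \<le> 2*pi"
  shows "integral {0..2*pi} (\<lambda>t. g (a + t)) = integral {0..2*pi} g"
proof -
  have int: "g integrable_on {x..y}" for x y
    by (intro integrable_continuous_real continuous_on_subset[OF cont]) auto
  have "integral {0..2*pi} (\<lambda>t. g (a + t)) = integral {a..2*pi+a} g"
    using integral_shift_Icc_real[of 0 "2*pi" g a] by (simp add: o_def)
  also have "\<dots> = integral {a..2*pi} g + integral {2*pi..2*pi+a} g"
    using a by (intro Henstock_Kurzweil_Integration.integral_combine[symmetric, OF _ _ int]) auto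
  also have "integral {2*pi..2*pi+a} g = integral {0..a} (\<lambda>t. g (2*pi + t))"
    using integral_shift_Icc_real[of 0 a g "2*pi"] by (simp add: o_def add.commute)
  also have "\<dots> = integral {0..a} g" using per by (simp add: add.commute)
  also have "integral {a..2*pi} g + integral {0..a} g = integral {0..2*pi} g"
    using a Henstock_Kurzweil_Integration.integral_combine[of 0 a "2*pi" g] int by simp
  finally show ?thesis .
qed

lemma integral_periodic_reflect:
  fixes g :: "real \<Rightarrow> real"
  assumes cont: "continuous_on UNIV g" and per: "\<And>t. g (t + 2*pi) = g t"
  shows "integral {0..2*pi} (\<lambda>t. g (- t)) = integral {0..2*pi} g"
proof -
  have "integral {0..2*pi} (\<lambda>t. g (- t)) = integral {- (2*pi)..0} g"
    using Henstock_Kurzweil_Integration.integral_reflect_real[of 0 "-(2*pi)" g] by simp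
  also have "\<dots> = integral {- (2*pi)..0} (\<lambda>t. g (t + 2*pi))" using per by simp
  also have "\<dots> = integral {0..2*pi} g"
    using integral_shift_real_ivl[of 0 "2*pi" "2*pi" g] by simp
  finally show ?thesis .
qed

lemma integral_cos_sin_nat:
  assumes "n \<ge> 1"
  shows "integral {0..2*pi} (\<lambda>t. cos (real n * t)) = 0" "integral {0..2*pi} (\<lambda>t. sin (real n * t)) = 0"
proof -
  have "((\<lambda>t. cos (real n * t)) has_integral (sin (real n * (2*pi)) / n - sin (real n * 0) / n)) {0..2*pi}"
    by (intro fundamental_theorem_of_calculus)
       (use assms in \<open>auto intro!: derivative_eq_intros simp flip: has_real_derivative_iff_has_vector_derivative\<close>)
  moreover have "sin (real n * (2*pi)) = 0" using sin_npi[of "2*n"] by (simp add: mult_ac)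
  ultimately show "integral {0..2*pi} (\<lambda>t. cos (real n * t)) = 0" by (simp add: integral_unique)
  have "((\<lambda>t. sin (real n * t)) has_integral (- cos (real n * (2*pi)) / n - (- cos (real n * 0) / n))) {0..2*pi}"
    by (intro fundamental_theorem_of_calculus)
       (use assms in \<open>auto intro!: derivative_eq_intros simp flip: has_real_derivative_iff_has_vector_derivative\<close>)
  moreover have "cos (real n * (2*pi)) = 1" using cos_npi[of "2*n"] by (simp add: mult_ac)
  ultimately show "integral {0..2*pi} (\<lambda>t. sin (real n * t)) = 0" by (simp add: integral_unique)
qed

lemma integral_first_harmonic_times_higher:
  assumes "k \<ge> 2"
  shows "integral {0..2*pi} (\<lambda>t. (\<beta> * cos t + \<gamma> * sin t) * cos (real k * t)) = 0"
    and "integral {0..2*pi} (\<lambda>t. (\<beta> * cos t + \<gamma> * sin t) * sin (real k * t)) = 0"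
proof -
  have up: "real (k+1) * t = real k * t + t" and down: "real (k-1) * t = real k * t - t" for t :: real
    using assms by (auto simp: algebra_simps)
  have C: "((\<lambda>t. a * cos (real n * t)) has_integral 0) {0..2*pi}"
    and S: "((\<lambda>t. a * sin (real n * t)) has_integral 0) {0..2*pi}" if "n \<ge> 1" for n a
    using integral_cos_sin_nat[OF that]
    by (auto simp: has_integral_integrable_integral intro!: integrable_continuous_real continuous_intros)
  have k: "k+1 \<ge> 1" "k-1 \<ge> 1" using assms by auto
  have "(\<beta> * cos t + \<gamma> * sin t) * cos (real k * t) =
       (\<beta>/2 * cos (real (k+1) * t) + \<beta>/2 * cos (real (k-1) * t)) + (\<gamma>/2 * sin (real (k+1) * t) - \<gamma>/2 * sin (real (k-1) * t))" for t
    unfolding up down by (simp add: cos_add cos_diff sin_add sin_diff field_simps)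
  then show "integral {0..2*pi} (\<lambda>t. (\<beta> * cos t + \<gamma> * sin t) * cos (real k * t)) = 0"
    by (simp only:) (subst integral_unique[OF has_integral_add[OF has_integral_add[OF C[OF k(1)] C[OF k(2)]] has_integral_diff[OF S[OF k(1)] S[OF k(2)]]]], simp)
  have "(\<beta> * cos t + \<gamma> * sin t) * sin (real k * t) =
       (\<beta>/2 * sin (real (k+1) * t) + \<beta>/2 * sin (real (k-1) * t)) + (\<gamma>/2 * cos (real (k-1) * t) - \<gamma>/2 * cos (real (k+1) * t))" for t
    unfolding up down by (simp add: cos_add cos_diff sin_add sin_diff field_simps)
  then show "integral {0..2*pi} (\<lambda>t. (\<beta> * cos t + \<gamma> * sin t) * sin (real k * t)) = 0"
    by (simp only:) (subst integral_unique[OF has_integral_add[OF has_integral_add[OF S[OF k(1)] S[OF k(2)]] has_integral_diff[OF C[OF k(2)] C[OF k(1)]]]], simp)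
qed

text \<open>Since the correction term is orthogonal to frequency k, the vector of the two coefficients is fixed
by a rotation of the plane by the angle k d, which is not the identity.\<close>

lemma Fourier_coeffs_eq_0:
  fixes g :: "real \<Rightarrow> real"
  assumes cont: "continuous_on UNIV g" and per: "\<And>t. g (t + 2*pi) = g t"
    and d: "0 \<le> d" "d \<le> 2*pi"
    and eq: "\<And>t. g (d + t) + (\<beta> * cos t + \<gamma> * sin t) = g t"
    and k: "k \<ge> 2" "cos (real k * d) \<noteq> 1"
  shows "integral {0..2*pi} (\<lambda>t. g t * cos (real k * t)) = 0"
    and "integral {0..2*pi} (\<lambda>t. g t * sin (real k * t)) = 0"
proof -
  define C where "C = integral {0..2*pi} (\<lambda>t. g t * cos (real k * t))"
  define S where "S = integral {0..2*pi} (\<lambda>t. g t * sin (real k * t))"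
  define c where "c = cos (real k * d)"
  define s where "s = sin (real k * d)"
  have contd: "continuous_on A (\<lambda>t. g (d + t))" for A
    by (rule continuous_on_compose2[OF cont]) (auto intro!: continuous_intros)
  have kper: "cos (real k * (t + 2*pi)) = cos (real k * t)" "sin (real k * (t + 2*pi)) = sin (real k * t)" for t
  proof -
    have "real k * (t + 2*pi) = real k * t + real (2*k) * pi" by (simp add: algebra_simps)
    then show "cos (real k * (t + 2*pi)) = cos (real k * t)" "sin (real k * (t + 2*pi)) = sin (real k * t)"
      by (simp_all only: cos_add sin_add cos_npi sin_npi) simp_all
  qed
  have "C = integral {0..2*pi} (\<lambda>t. g (d + t) * cos (real k * (d + t)))"
    unfolding C_def
    by (rule integral_periodic_shift[symmetric]) (auto intro!: continuous_intros continuous_on_subset[OF cont] simp: per kper d)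
  also have "\<dots> = integral {0..2*pi} (\<lambda>t. c * (g (d + t) * cos (real k * t)) - s * (g (d + t) * sin (real k * t)))"
    by (intro integral_cong) (simp add: distrib_left cos_add c_def s_def algebra_simps)
  also have "\<dots> = c * integral {0..2*pi} (\<lambda>t. g (d + t) * cos (real k * t))
     - s * integral {0..2*pi} (\<lambda>t. g (d + t) * sin (real k * t))"
    by (subst integral_diff) (auto intro!: integrable_continuous_real continuous_intros contd)
  finally have C: "C = c * integral {0..2*pi} (\<lambda>t. g (d + t) * cos (real k * t))
     - s * integral {0..2*pi} (\<lambda>t. g (d + t) * sin (real k * t))" .
  have "S = integral {0..2*pi} (\<lambda>t. g (d + t) * sin (real k * (d + t)))"
    unfolding S_def
    by (rule integral_periodic_shift[symmetric]) (auto intro!: continuous_intros continuous_on_subset[OF cont] simp: per kper d)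
  also have "\<dots> = integral {0..2*pi} (\<lambda>t. s * (g (d + t) * cos (real k * t)) + c * (g (d + t) * sin (real k * t)))"
    by (intro integral_cong) (simp add: distrib_left sin_add c_def s_def algebra_simps)
  also have "\<dots> = s * integral {0..2*pi} (\<lambda>t. g (d + t) * cos (real k * t))
     + c * integral {0..2*pi} (\<lambda>t. g (d + t) * sin (real k * t))"
    by (subst integral_add) (auto intro!: integrable_continuous_real continuous_intros contd)
  finally have S: "S = s * integral {0..2*pi} (\<lambda>t. g (d + t) * cos (real k * t))
     + c * integral {0..2*pi} (\<lambda>t. g (d + t) * sin (real k * t))" .
  have gd: "g (d + t) = g t - (\<beta> * cos t + \<gamma> * sin t)" for t using eq[of t] by simp
  have gC: "integral {0..2*pi} (\<lambda>t. g (d + t) * cos (real k * t)) = C"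
    unfolding gd left_diff_distrib C_def
    by (subst integral_diff)
       (auto intro!: integrable_continuous_real continuous_intros continuous_on_subset[OF cont]
         simp: integral_first_harmonic_times_higher[OF k(1)])
  have gS: "integral {0..2*pi} (\<lambda>t. g (d + t) * sin (real k * t)) = S"
    unfolding gd left_diff_distrib S_def
    by (subst integral_diff)
       (auto intro!: integrable_continuous_real continuous_intros continuous_on_subset[OF cont]
         simp: integral_first_harmonic_times_higher[OF k(1)])
  note CS = C[unfolded gC gS] S[unfolded gC gS]
  have "((1-c)\<^sup>2 + s\<^sup>2) * C = 0" "((1-c)\<^sup>2 + s\<^sup>2) * S = 0" using CS by algebra+
  moreover have "(1-c)\<^sup>2 + s\<^sup>2 > 0" using k(2) unfolding c_def[symmetric]
    by (intro add_pos_nonneg) auto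
  ultimately show "integral {0..2*pi} (\<lambda>t. g t * cos (real k * t)) = 0"
    "integral {0..2*pi} (\<lambda>t. g t * sin (real k * t)) = 0"
    unfolding C_def[symmetric] S_def[symmetric] by auto
qed

lemma cos_neq_1:
  assumes "0 < x" "x < 2*pi" shows "cos x \<noteq> 1"
proof
  assume "cos x = 1"
  then obtain n :: int where n: "x = n * 2 * pi" by (auto simp: cos_one_2pi_int)
  with assms have "0 < real_of_int n" "real_of_int n < 1" by (auto simp: zero_less_mult_iff)
  then show False by simp
qed

lemma norm_cos_sin_orthonormal:
  assumes "norm u = 1" "norm v = 1" "u \<bullet> v = 0"
  shows "norm (cos t *\<^sub>R u + sin t *\<^sub>R v) = 1"
proof -
  have "(norm (cos t *\<^sub>R u + sin t *\<^sub>R v))\<^sup>2 = 1"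
    using assms
    by (simp add: power2_norm_eq_inner inner_add_left inner_add_right inner_commute[of v u] norm_eq_1
          flip: power2_eq_square)
  then show ?thesis by (simp add: power2_eq_1_iff) (metis norm_ge_zero neg_0_le_iff_le not_one_le_zero)
qed

text \<open>The rotation supplied for the plane comes with its own orthonormal basis (u, v), while A, B are
prescribed. The two parametrisations of the circle differ by a shift of the angle and possibly a
reflection; both preserve the vanishing of the coefficients of a given frequency.\<close>

lemma great_circle_Fourier_coeff_eq_0:
  fixes f :: "'a::euclidean_space \<Rightarrow> real"
  assumes cont: "continuous_on (sphere 0 1) f"
    and hyp: "\<And>P. subspace P \<Longrightarrow> dim P = 2 \<Longrightarrow>
           (\<exists>q::nat. q \<ge> 4 \<and>
             (\<exists>\<phi> b. rotation_of_plane P (2 * pi / real q) \<phi> \<and> b \<in> P \<and>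
               (\<forall>x \<in> sphere 0 1 \<inter> P. f (\<phi> x) + b \<bullet> x = f x)))"
    and AB: "norm A = 1" "norm B = 1" "A \<bullet> B = 0"
    and k: "k = 2 \<or> k = 3"
  shows "integral {0..2*pi} (\<lambda>t. f (cos t *\<^sub>R A + sin t *\<^sub>R B) * cos (real k * t)) = 0"
proof -
  have "A \<noteq> B" using AB by (auto simp: norm_eq_1)
  moreover have "independent {A, B}"
    using AB by (intro pairwise_orthogonal_independent) (auto simp: pairwise_def orthogonal_def inner_commute)
  ultimately have "dim (span {A,B}) = 2"
    by (simp add: dim_span dim_eq_card_independent)
  with hyp[of "span {A,B}"] obtain q \<phi> b where q: "q \<ge> 4"
    and rot: "rotation_of_plane (span {A,B}) (2 * pi / real q) \<phi>" and "b \<in> span {A,B}"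
    and b: "\<And>x. x \<in> sphere 0 1 \<inter> span {A,B} \<Longrightarrow> f (\<phi> x) + b \<bullet> x = f x"
    by (auto simp: subspace_span)
  define d where "d = 2 * pi / real q"
  from rot obtain u v where uv: "norm u = 1" "norm v = 1" "u \<bullet> v = 0" "span {u,v} = span {A,B}"
    and \<phi>: "\<And>s t. \<phi> (s *\<^sub>R u + t *\<^sub>R v) =
           (cos d * s - sin d * t) *\<^sub>R u + (sin d * s + cos d * t) *\<^sub>R v"
    unfolding rotation_of_plane_def d_def by blast
  define e where "e t = cos t *\<^sub>R u + sin t *\<^sub>R v" for t
  have e_norm: "norm (e t) = 1" for t unfolding e_def by (rule norm_cos_sin_orthonormal[OF uv(1-3)])
  define g where "g t = f (e t)" for t
  have g_cont: "continuous_on UNIV g"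
    unfolding g_def
    by (rule continuous_on_compose2[OF cont]) (auto simp: e_norm, auto simp: e_def intro!: continuous_intros)
  have g_per: "g (t + 2*pi) = g t" for t by (simp add: g_def e_def)
  have g_eq: "g (d + t) + ((b \<bullet> u) * cos t + (b \<bullet> v) * sin t) = g t" for t
  proof -
    have "e t \<in> span {u,v}" unfolding e_def by (intro span_add span_scale span_base) auto
    then have "f (\<phi> (e t)) + b \<bullet> e t = f (e t)" using e_norm uv(4) by (intro b) auto
    moreover have "\<phi> (e t) = e (d + t)"
      unfolding e_def \<phi> by (simp add: cos_add sin_add algebra_simps)
    moreover have "b \<bullet> e t = (b \<bullet> u) * cos t + (b \<bullet> v) * sin t"
      by (simp add: e_def inner_add_right mult.commute)
    ultimately show ?thesis by (simp add: g_def)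
  qed
  have d: "0 < d" "real k * d < 2 * pi" "d \<le> 2 * pi" "k \<ge> 2"
    using q k by (auto simp: d_def field_simps)
  then have cos1: "cos (real k * d) \<noteq> 1" by (intro cos_neq_1) auto
  note fourier = Fourier_coeffs_eq_0[OF g_cont g_per less_imp_le[OF d(1)] d(3) g_eq d(4) cos1]
  have "A \<in> span {u,v}" "B \<in> span {u,v}" using uv(4) by (auto intro: span_base)
  have expand: "x = (u \<bullet> x) *\<^sub>R u + (v \<bullet> x) *\<^sub>R v" if "x \<in> span {u,v}" for x
  proof -
    from that obtain s t where "x = s *\<^sub>R u + t *\<^sub>R v"
      by (auto simp: span_breakdown_eq eq_diff_eq diff_eq_eq) (metis add.commute)
    then show ?thesis using uv by (simp add: inner_add_right inner_commute[of v u] norm_eq_1)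
  qed
  have inner_expand: "x \<bullet> y = (u \<bullet> x) * (u \<bullet> y) + (v \<bullet> x) * (v \<bullet> y)" if "x \<in> span {u,v}" for x y
    by (subst expand[OF that]) (simp add: inner_add_left)
  define a1 a2 b1 b2 where "a1 = u \<bullet> A" and "a2 = v \<bullet> A" and "b1 = u \<bullet> B" and "b2 = v \<bullet> B"
  note A = expand[OF \<open>A \<in> span {u,v}\<close>, folded a1_def a2_def]
  note B = expand[OF \<open>B \<in> span {u,v}\<close>, folded b1_def b2_def]
  have AA: "a1\<^sup>2 + a2\<^sup>2 = 1" and BB: "b1\<^sup>2 + b2\<^sup>2 = 1" and AB0: "a1 * b1 + a2 * b2 = 0"
    using AB inner_expand[OF \<open>A \<in> span {u,v}\<close>] inner_expand[OF \<open>B \<in> span {u,v}\<close>]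
    by (auto simp: norm_eq_1 a1_def a2_def b1_def b2_def power2_eq_square)
  obtain \<alpha> where \<alpha>: "0 \<le> \<alpha>" "\<alpha> < 2*pi" "a1 = cos \<alpha>" "a2 = sin \<alpha>"
    using sincos_total_2pi[OF AA] by metis
  \<comment> \<open>The sign is the determinant of the change of basis.\<close>
  obtain \<sigma> :: real where \<sigma>: "\<sigma> = 1 \<or> \<sigma> = -1" "b1 = - \<sigma> * a2" "b2 = \<sigma> * a1"
  proof
    show "a1 * b2 - a2 * b1 = 1 \<or> a1 * b2 - a2 * b1 = -1"
    proof -
      have "(a1 * b2 - a2 * b1)\<^sup>2 = (a1\<^sup>2 + a2\<^sup>2) * (b1\<^sup>2 + b2\<^sup>2) - (a1 * b1 + a2 * b2)\<^sup>2" by algebra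
      then show ?thesis using AA BB AB0 by (simp add: power2_eq_1_iff)
    qed
    show "b1 = - (a1 * b2 - a2 * b1) * a2" "b2 = (a1 * b2 - a2 * b1) * a1"
      using AA AB0 by algebra+
  qed
  have rw: "f (cos t *\<^sub>R A + sin t *\<^sub>R B) = g (\<alpha> + \<sigma> * t)" for t
  proof -
    have "cos (\<sigma> * t) = cos t" "sin (\<sigma> * t) = \<sigma> * sin t" using \<sigma>(1) by auto
    then have "cos t *\<^sub>R A + sin t *\<^sub>R B = e (\<alpha> + \<sigma> * t)"
      unfolding e_def by (subst A, subst B) (simp add: \<sigma> \<alpha> cos_add sin_add algebra_simps)
    then show ?thesis by (simp add: g_def)
  qed
  define h where "h x = g x * cos (real k * (x - \<alpha>))" for x
  have h_eq: "h x = cos (real k * \<alpha>) * (g x * cos (real k * x)) + sin (real k * \<alpha>) * (g x * sin (real k * x))" for x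
    by (simp add: h_def right_diff_distrib cos_diff algebra_simps)
  have h_cont: "continuous_on UNIV h" unfolding h_def by (intro continuous_intros g_cont)
  have h_per: "h (t + 2*pi) = h t" for t
  proof -
    have "real k * (t + 2*pi - \<alpha>) = real k * (t - \<alpha>) + real (2*k) * pi" by (simp add: algebra_simps)
    then show ?thesis unfolding h_def g_per by (simp only: cos_add cos_npi sin_npi) simp
  qed
  have h0: "integral {0..2*pi} h = 0"
    unfolding h_eq
    by (subst integral_add) (auto intro!: integrable_continuous_real continuous_intros continuous_on_subset[OF g_cont] simp: fourier)
  have ha_cont: "continuous_on UNIV (\<lambda>t. h (\<alpha> + t))"
    by (rule continuous_on_compose2[OF h_cont]) (auto intro!: continuous_intros)
  have ha: "integral {0..2*pi} (\<lambda>t. h (\<alpha> + t)) = 0"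
    using integral_periodic_shift[OF h_cont h_per, of \<alpha>] \<alpha> h0 by simp
  have "f (cos t *\<^sub>R A + sin t *\<^sub>R B) * cos (real k * t) = h (\<alpha> + \<sigma> * t)" for t
    unfolding rw h_def using \<sigma>(1) by auto
  moreover have "integral {0..2*pi} (\<lambda>t. h (\<alpha> + \<sigma> * t)) = 0"
    using \<sigma>(1) ha integral_periodic_reflect[OF ha_cont] h_per by (auto simp: add.assoc[symmetric])
  ultimately show ?thesis by simp
qed

section \<open>An integral equation for functions on an interval\<close>

lemma integral_cos_power_Suc_Suc:
  "integral {0..2*pi} (\<lambda>t. cos t ^ (m+2)) = (m+1) / (m+2) * integral {0..2*pi} (\<lambda>t. cos t ^ m)"
proof -
  have "((\<lambda>t. (m+2) * cos t ^ (m+2) - (m+1) * cos t ^ m) has_integral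
          (sin (2*pi) * cos (2*pi) ^ (m+1) - sin 0 * cos 0 ^ (m+1))) {0..2*pi}"
  proof (rule fundamental_theorem_of_calculus)
    fix t :: real
    have sin_sin: "sin t * (sin t * x) = x - cos t * (cos t * x)" for x :: real
      using sin_cos_squared_add[of t] by algebra
    have "((\<lambda>t. sin t * cos t ^ (m+1)) has_real_derivative
             ((m+2) * cos t ^ (m+2) - (m+1) * cos t ^ m)) (at t within {0..2*pi})"
      by (rule derivative_eq_intros refl)+
         (simp add: algebra_simps sin_sin)
    then show "((\<lambda>t. sin t * cos t ^ (m+1)) has_vector_derivative
             ((m+2) * cos t ^ (m+2) - (m+1) * cos t ^ m)) (at t within {0..2*pi})"
      by (simp add: has_real_derivative_iff_has_vector_derivative)
  qed simp
  then have "integral {0..2*pi} (\<lambda>t. (m+2) * cos t ^ (m+2) - (m+1) * cos t ^ m) = 0"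
    by (simp add: integral_unique)
  moreover have "integral {0..2*pi} (\<lambda>t. (m+2) * cos t ^ (m+2) - (m+1) * cos t ^ m) =
      (m+2) * integral {0..2*pi} (\<lambda>t. cos t ^ (m+2)) - (m+1) * integral {0..2*pi} (\<lambda>t. cos t ^ m)"
    by (subst integral_diff) (auto intro!: integrable_continuous_real continuous_intros simp del: power_Suc)
  ultimately show ?thesis by (simp add: field_simps)
qed

lemma integral_sin_power_Suc_Suc:
  "integral {0..pi/2} (\<lambda>t. sin t ^ (m+3)) = (m+2) / (m+3) * integral {0..pi/2} (\<lambda>t. sin t ^ (m+1))"
proof -
  have "((\<lambda>t. (m+3) * sin t ^ (m+3) - (m+2) * sin t ^ (m+1)) has_integral
          (- cos (pi/2) * sin (pi/2) ^ (m+2) - - cos 0 * sin 0 ^ (m+2))) {0..pi/2}"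
  proof (rule fundamental_theorem_of_calculus)
    fix t :: real
    have cos_cos: "cos t * (cos t * x) = x - sin t * (sin t * x)" for x :: real
      using sin_cos_squared_add[of t] by algebra
    have "((\<lambda>t. - cos t * sin t ^ (m+2)) has_real_derivative
             ((m+3) * sin t ^ (m+3) - (m+2) * sin t ^ (m+1))) (at t within {0..pi/2})"
      by (rule derivative_eq_intros refl)+
         (simp add: algebra_simps cos_cos eval_nat_numeral)
    then show "((\<lambda>t. - cos t * sin t ^ (m+2)) has_vector_derivative
             ((m+3) * sin t ^ (m+3) - (m+2) * sin t ^ (m+1))) (at t within {0..pi/2})"
      by (simp add: has_real_derivative_iff_has_vector_derivative)
  qed simp
  then have "integral {0..pi/2} (\<lambda>t. (m+3) * sin t ^ (m+3) - (m+2) * sin t ^ (m+1)) = 0"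
    by (simp add: integral_unique)
  moreover have "integral {0..pi/2} (\<lambda>t. (m+3) * sin t ^ (m+3) - (m+2) * sin t ^ (m+1)) =
      (m+3) * integral {0..pi/2} (\<lambda>t. sin t ^ (m+3)) - (m+2) * integral {0..pi/2} (\<lambda>t. sin t ^ (m+1))"
    by (subst integral_diff) (auto intro!: integrable_continuous_real continuous_intros simp del: power_Suc)
  ultimately show ?thesis by (simp add: field_simps)
qed

text \<open>The recursions of the two Wallis integrals telescope against each other, so that only the product
has a simple closed form.\<close>

lemma integral_sin_power_times_integral_cos_power:
  "integral {0..pi/2} (\<lambda>b. sin b ^ (m+1)) * integral {0..2*pi} (\<lambda>t. cos t ^ m)
     = (1 + (-1)^m) * pi / (m+1)"
proof (induction m rule: nat_induct2)
  case 0
  have "integral {0..pi/2} sin = (1::real)" using integral_sin[of 0 "pi/2"] by simp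
  then show ?case by simp
next
  case 1
  have "integral {0..2*pi} cos = (0::real)"
    using integral_cos[of 0 "2*pi"] by simp
  then show ?case by simp
next
  case (step m)
  have "m+2+1 = m+3" by simp
  then have "integral {0..pi/2} (\<lambda>b. sin b ^ (m+2+1)) * integral {0..2*pi} (\<lambda>t. cos t ^ (m+2))
    = (m+1)/(m+3) * (integral {0..pi/2} (\<lambda>b. sin b ^ (m+1)) * integral {0..2*pi} (\<lambda>t. cos t ^ m))"
    using integral_cos_power_Suc_Suc[of m] integral_sin_power_Suc_Suc[of m]
    by (simp only:) (simp add: divide_simps)
  also have "\<dots> = (1 + (-1)^m) * pi / (m+3)"
    unfolding step by (simp add: divide_simps del: distrib_right_numeral) 
  finally show ?case by simp
qed

text \<open>With c = 1 the factor is cos (2 t). With c = 3 it is cos (3 t) / cos t, so that for G z = z * g z the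
integrand is s times g (s cos t) cos (3 t). The parameter c treats both frequencies at once.\<close>

definition circle_integral :: "real \<Rightarrow> (real \<Rightarrow> real) \<Rightarrow> real \<Rightarrow> real" where
  "circle_integral c G s = integral {0..2*pi} (\<lambda>t. G (s * cos t) * ((c+1) * (cos t)\<^sup>2 - c))"

lemma times_cos_in_Icc: "s \<in> {-1..1} \<Longrightarrow> s * cos t \<in> {-1..1::real}"
  using mult_le_one[of "\<bar>s\<bar>" "\<bar>cos t\<bar>"] by (auto simp: abs_mult[symmetric] abs_le_iff)

lemma continuous_on_circle_integrand:
  assumes "continuous_on {-1..1} G" "s \<in> {-1..1}"
  shows "continuous_on A (\<lambda>t. G (s * cos t) * ((c+1) * (cos t)\<^sup>2 - c::real))"
proof -
  have "continuous_on A (\<lambda>t. G (s * cos t))"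
    by (rule continuous_on_compose2[OF assms(1)], intro continuous_intros)
       (use times_cos_in_Icc[OF assms(2)] in blast)
  then show ?thesis by (intro continuous_intros)
qed

lemma continuous_on_circle_integral:
  assumes "continuous_on {-1..1} G"
  shows "continuous_on {-1..1} (circle_integral c G)"
proof -
  have "continuous_on ({-1..1} \<times> cbox 0 (2*pi)) (\<lambda>x. G (fst x * cos (snd x)))"
    by (rule continuous_on_compose2[OF assms(1)], intro continuous_intros)
       (metis (no_types, lifting) times_cos_in_Icc SigmaE fst_conv image_subsetI)
  then have "continuous_on ({-1..1} \<times> cbox 0 (2*pi))
      (\<lambda>(s,t). G (s * cos t) * ((c+1) * (cos t)\<^sup>2 - c))"
    unfolding split_def by (intro continuous_intros)
  from integral_continuous_on_param[OF this] show ?thesis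
    by (simp add: circle_integral_def[abs_def])
qed

lemma continuous_on_sin_circle_integral:
  assumes "continuous_on {-1..1} G"
  shows "continuous_on {0..pi/2} (\<lambda>b. sin b * circle_integral c G (sin b))"
  by (intro continuous_intros continuous_on_compose2[OF continuous_on_circle_integral[OF assms]])
     auto

lemma circle_integral_diff:
  assumes "continuous_on {-1..1} G" "continuous_on {-1..1} H" "s \<in> {-1..1}"
  shows "circle_integral c (\<lambda>z. G z - H z) s = circle_integral c G s - circle_integral c H s"
  unfolding circle_integral_def left_diff_distrib
  by (rule integral_diff; intro integrable_continuous_real continuous_on_circle_integrand assms)

lemma circle_integral_sum:
  assumes "\<And>i. i \<in> I \<Longrightarrow> continuous_on {-1..1} (G i)" "s \<in> {-1..1}" "finite I"
  shows "circle_integral c (\<lambda>z. \<Sum>i\<in>I. a i * G i z) s = (\<Sum>i\<in>I. a i * circle_integral c (G i) s)"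
proof -
  have "circle_integral c (\<lambda>z. \<Sum>i\<in>I. a i * G i z) s =
     integral {0..2*pi} (\<lambda>t. \<Sum>i\<in>I. a i * (G i (s * cos t) * ((c+1) * (cos t)\<^sup>2 - c)))"
    unfolding circle_integral_def by (simp add: sum_distrib_right mult.assoc)
  also have "\<dots> = (\<Sum>i\<in>I. a i * circle_integral c (G i) s)"
    unfolding circle_integral_def
    by (subst integral_sum)
       (use assms in \<open>auto intro!: integrable_continuous_real continuous_on_circle_integrand continuous_on_mult_left\<close>)
  finally show ?thesis .
qed

text \<open>The defect of an identity of Archimedes type, which will turn out to hold for every continuous G. On
the hemisphere with coordinates (sin b cos t, sin b sin t, cos b) the area element is sin b db dt,
and the first integral is that of G (x) ((c+1) cos^2 t - c), x being the first coordinate. The half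
circle x = z carries the measure pi dz, and the mean of cos^2 t over it is the absolute value of z;
this gives the second integral.\<close>

definition sphere_defect :: "real \<Rightarrow> (real \<Rightarrow> real) \<Rightarrow> real" where
  "sphere_defect c G = integral {0..pi/2} (\<lambda>b. sin b * circle_integral c G (sin b))
     - pi * integral {0..1} (\<lambda>z. (G z + G (-z)) * ((c+1) * z - c))"

lemma continuous_on_even_integrand:
  assumes "continuous_on {-1..1} G"
  shows "continuous_on {0..1} (\<lambda>z. (G z + G (-z)) * ((c+1) * z - c :: real))"
  by (intro continuous_intros continuous_on_compose2[OF assms]) auto

lemma sphere_defect_diff:
  assumes "continuous_on {-1..1} G" "continuous_on {-1..1} H"
  shows "sphere_defect c (\<lambda>z. G z - H z) = sphere_defect c G - sphere_defect c H"
proof -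
  have "integral {0..pi/2} (\<lambda>b. sin b * circle_integral c (\<lambda>z. G z - H z) (sin b)) =
      integral {0..pi/2} (\<lambda>b. sin b * circle_integral c G (sin b) - sin b * circle_integral c H (sin b))"
    by (intro integral_cong) (simp add: circle_integral_diff assms algebra_simps)
  also have "\<dots> = integral {0..pi/2} (\<lambda>b. sin b * circle_integral c G (sin b))
     - integral {0..pi/2} (\<lambda>b. sin b * circle_integral c H (sin b))"
    by (intro integral_diff integrable_continuous_real continuous_on_sin_circle_integral assms)
  finally have 1: "integral {0..pi/2} (\<lambda>b. sin b * circle_integral c (\<lambda>z. G z - H z) (sin b)) =
      integral {0..pi/2} (\<lambda>b. sin b * circle_integral c G (sin b))
     - integral {0..pi/2} (\<lambda>b. sin b * circle_integral c H (sin b))" .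
  have "integral {0..1} (\<lambda>z. (G z - H z + (G (-z) - H (-z))) * ((c+1) * z - c)) =
     integral {0..1} (\<lambda>z. (G z + G (-z)) * ((c+1) * z - c) - (H z + H (-z)) * ((c+1) * z - c))"
    by (intro integral_cong) (simp add: algebra_simps)
  also have "\<dots> = integral {0..1} (\<lambda>z. (G z + G (-z)) * ((c+1) * z - c))
      - integral {0..1} (\<lambda>z. (H z + H (-z)) * ((c+1) * z - c))"
    by (intro integral_diff integrable_continuous_real continuous_on_even_integrand assms)
  finally show ?thesis
    unfolding sphere_defect_def 1 by (simp only: right_diff_distrib)
qed

lemma sphere_defect_sum:
  assumes "\<And>i. i \<in> I \<Longrightarrow> continuous_on {-1..1} (G i)" "finite I"
  shows "sphere_defect c (\<lambda>z. \<Sum>i\<in>I. a i * G i z) = (\<Sum>i\<in>I. a i * sphere_defect c (G i))"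
proof -
  have "integral {0..pi/2} (\<lambda>b. sin b * circle_integral c (\<lambda>z. \<Sum>i\<in>I. a i * G i z) (sin b)) =
      integral {0..pi/2} (\<lambda>b. \<Sum>i\<in>I. a i * (sin b * circle_integral c (G i) (sin b)))"
    by (intro integral_cong) (simp add: circle_integral_sum assms sum_distrib_left mult.left_commute)
  also have "\<dots> = (\<Sum>i\<in>I. a i * integral {0..pi/2} (\<lambda>b. sin b * circle_integral c (G i) (sin b)))"
    by (subst integral_sum)
       (use assms in \<open>auto intro!: integrable_continuous_real continuous_on_mult_left continuous_on_sin_circle_integral\<close>)
  finally have 1: "integral {0..pi/2} (\<lambda>b. sin b * circle_integral c (\<lambda>z. \<Sum>i\<in>I. a i * G i z) (sin b)) =
    (\<Sum>i\<in>I. a i * integral {0..pi/2} (\<lambda>b. sin b * circle_integral c (G i) (sin b)))" .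
  have "integral {0..1} (\<lambda>z. ((\<Sum>i\<in>I. a i * G i z) + (\<Sum>i\<in>I. a i * G i (-z))) * ((c+1) * z - c)) =
     integral {0..1} (\<lambda>z. \<Sum>i\<in>I. a i * ((G i z + G i (-z)) * ((c+1) * z - c)))"
    by (intro integral_cong)
       (simp only: sum.distrib[symmetric] sum_distrib_right distrib_left[symmetric] mult.assoc)
  also have "\<dots> = (\<Sum>i\<in>I. a i * integral {0..1} (\<lambda>z. (G i z + G i (-z)) * ((c+1) * z - c)))"
    by (subst integral_sum)
       (use assms in \<open>auto intro!: integrable_continuous_real continuous_on_mult_left continuous_on_even_integrand\<close>)
  finally show ?thesis
    unfolding sphere_defect_def 1
    by (simp add: sum_distrib_left right_diff_distrib sum_subtractf mult.left_commute)
qed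

text \<open>For monomials both integrals are explicit. Together with linearity, a bound by the supremum norm
and the Weierstrass approximation theorem this gives the identity for continuous functions.\<close>

lemma sphere_defect_power: "sphere_defect c (\<lambda>z. z ^ m) = 0"
proof -
  define W where "W = integral {0..2*pi} (\<lambda>t. cos t ^ m)"
  define V where "V = integral {0..pi/2} (\<lambda>b. sin b ^ (m+1))"
  have VW: "V * W = (1 + (-1)^m) * pi / (m+1)"
    unfolding V_def W_def by (rule integral_sin_power_times_integral_cos_power)
  have ck: "circle_integral c (\<lambda>z. z ^ m) s = s ^ m * (W * ((m + 1 - c) / (m+2)))" for s
  proof -
    have "circle_integral c (\<lambda>z. z ^ m) s =
       integral {0..2*pi} (\<lambda>t. s ^ m * ((c+1) * cos t ^ (m+2) - c * cos t ^ m))"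
      unfolding circle_integral_def by (simp add: algebra_simps power2_eq_square)
    also have "\<dots> = s ^ m * ((c+1) * integral {0..2*pi} (\<lambda>t. cos t ^ (m+2)) - c * W)"
      unfolding W_def
      by (subst integral_mult_right, subst integral_diff)
         (auto intro!: integrable_continuous_real continuous_intros simp del: power_Suc)
    also have "(c+1) * integral {0..2*pi} (\<lambda>t. cos t ^ (m+2)) - c * W = W * ((m + 1 - c) / (m+2))"
    proof -
      have coeff: "(c+1) * ((m+1) / (m+2)) - c = (m + 1 - c) / (m+2)"
        by (simp add: divide_simps) (simp add: algebra_simps)
      show ?thesis
        unfolding integral_cos_power_Suc_Suc W_def[symmetric] coeff[symmetric]
        by (simp only: right_diff_distrib mult_ac of_nat_add of_nat_1 of_nat_numeral)
    qed
    finally show ?thesis .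
  qed
  have "integral {0..pi/2} (\<lambda>b. sin b * circle_integral c (\<lambda>z. z ^ m) (sin b)) =
      integral {0..pi/2} (\<lambda>b. sin b ^ (m+1) * (W * ((m + 1 - c) / (m+2))))"
    by (simp add: ck mult_ac)
  also have "\<dots> = V * W * ((m + 1 - c) / (m+2))"
    unfolding V_def by simp
  finally have 1: "integral {0..pi/2} (\<lambda>b. sin b * circle_integral c (\<lambda>z. z ^ m) (sin b)) =
      (1 + (-1)^m) * pi / (m+1) * ((m + 1 - c) / (m+2))"
    unfolding VW .
  have "((\<lambda>z. (z^m + (-z)^m) * ((c+1) * z - c)) has_integral
      ((1 + (-1)^m) * ((c+1) * 1^(m+2)/(m+2) - c * 1^(m+1)/(m+1))
        - (1 + (-1)^m) * ((c+1) * 0^(m+2)/(m+2) - c * 0^(m+1)/(m+1)))) {0..1}"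
  proof (rule fundamental_theorem_of_calculus)
    fix z :: real
    have "((\<lambda>z. (1 + (-1)^m) * ((c+1) * z^(m+2)/(m+2) - c * z^(m+1)/(m+1))) has_real_derivative
         (1 + (-1)^m) * ((c+1) * z^(m+1) - c * z^m)) (at z within {0..1})"
      by (rule derivative_eq_intros refl | simp)+
    moreover have "(1 + (-1)^m) * ((c+1) * z^(m+1) - c * z^m) = (z^m + (-z)^m) * ((c+1) * z - c)"
      by (subst power_minus) (simp add: algebra_simps)
    ultimately show "((\<lambda>z. (1 + (-1)^m) * ((c+1) * z^(m+2)/(m+2) - c * z^(m+1)/(m+1)))
         has_vector_derivative (z^m + (-z)^m) * ((c+1) * z - c)) (at z within {0..1})"
      by (simp add: has_real_derivative_iff_has_vector_derivative)
  qed simp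
  then have "integral {0..1} (\<lambda>z. (z^m + (-z)^m) * ((c+1) * z - c)) =
      (1 + (-1)^m) * ((c+1)/(m+2) - c/(m+1))"
    by (simp add: integral_unique)
  also have "(c+1)/(m+2) - c/(m+1) = (m + 1 - c) / (m+2) / (m+1)"
    by (simp add: divide_simps) (simp add: algebra_simps)
  finally show ?thesis
    unfolding sphere_defect_def 1 by simp
qed

lemma abs_affine_le:
  fixes c x :: real
  assumes "0 \<le> c" "0 \<le> x" "x \<le> 1"
  shows "\<bar>(c+1) * x - c\<bar> \<le> 2*c+1"
proof -
  have "0 \<le> (c+1) * x" "(c+1) * x \<le> c+1"
    using assms mult_left_mono[of x 1 "c+1"] by simp_all
  moreover have "0 \<le> y \<Longrightarrow> y \<le> c+1 \<Longrightarrow> \<bar>y - c\<bar> \<le> 2*c+1" for y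
    using assms(1) by linarith
  ultimately show ?thesis by blast
qed

lemma abs_circle_integral_le:
  assumes "continuous_on {-1..1} G" "\<And>z. \<bar>z\<bar> \<le> 1 \<Longrightarrow> \<bar>G z\<bar> \<le> e" "s \<in> {-1..1}" "c \<ge> 0"
  shows "\<bar>circle_integral c G s\<bar> \<le> 2 * pi * (2*c+1) * e"
proof -
  have k: "\<bar>(c+1) * (cos t)\<^sup>2 - c\<bar> \<le> 2*c+1" for t
    using assms(4) by (intro abs_affine_le) (auto simp: abs_square_le_1)
  have "norm (circle_integral c G s) \<le> (e * (2*c+1)) * (2*pi - 0)"
    unfolding circle_integral_def
  proof (rule integral_bound)
    fix t
    show "norm (G (s * cos t) * ((c+1) * (cos t)\<^sup>2 - c)) \<le> e * (2*c+1)"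
      unfolding real_norm_def abs_mult
      by (rule mult_mono) (use k assms(2)[of "s * cos t"] times_cos_in_Icc[OF assms(3), of t] assms(2)[of 0] in \<open>auto simp: abs_le_iff intro: order_trans[OF abs_ge_zero]\<close>)
  qed (auto intro!: continuous_on_circle_integrand assms)
  then show ?thesis by (simp add: mult_ac)
qed

lemma abs_sphere_defect_le:
  assumes "continuous_on {-1..1} G" "\<And>z. \<bar>z\<bar> \<le> 1 \<Longrightarrow> \<bar>G z\<bar> \<le> e" "c \<ge> 0"
  shows "\<bar>sphere_defect c G\<bar> \<le> (pi * pi * (2*c+1) + 2 * pi * (2*c+1)) * e"
proof -
  have e: "e \<ge> 0" using assms(2)[of 0] by simp
  have "norm (integral {0..pi/2} (\<lambda>b. sin b * circle_integral c G (sin b))) \<le> (2 * pi * (2*c+1) * e) * (pi/2 - 0)"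
  proof (rule integral_bound)
    fix b
    have "\<bar>sin b\<bar> * \<bar>circle_integral c G (sin b)\<bar> \<le> 1 * (2 * pi * (2*c+1) * e)"
      by (intro mult_mono abs_circle_integral_le assms) auto
    then show "norm (sin b * circle_integral c G (sin b)) \<le> 2 * pi * (2*c+1) * e"
      by (simp add: abs_mult)
  qed (auto intro: continuous_on_sin_circle_integral assms)
  moreover have "norm (integral {0..1} (\<lambda>z. (G z + G (-z)) * ((c+1) * z - c))) \<le> (2 * e * (2*c+1)) * (1 - 0)"
  proof (rule integral_bound)
    fix z :: real assume z: "z \<in> {0..1}"
    have "\<bar>(c+1) * z - c\<bar> \<le> 2*c+1"
      using assms(3) z by (intro abs_affine_le) auto
    moreover have "\<bar>G z + G (-z)\<bar> \<le> 2 * e"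
      using assms(2)[of z] assms(2)[of "-z"] z by auto
    ultimately show "norm ((G z + G (-z)) * ((c+1) * z - c)) \<le> 2 * e * (2*c+1)"
      unfolding real_norm_def abs_mult by (intro mult_mono) (use e in auto)
  qed (auto intro: continuous_on_even_integrand assms)
  ultimately have "\<bar>integral {0..pi/2} (\<lambda>b. sin b * circle_integral c G (sin b))\<bar>
      + pi * \<bar>integral {0..1} (\<lambda>z. (G z + G (-z)) * ((c+1) * z - c))\<bar>
      \<le> (2 * pi * (2*c+1) * e) * (pi/2 - 0) + pi * ((2 * e * (2*c+1)) * (1 - 0))"
    unfolding real_norm_def by (intro add_mono mult_left_mono) auto
  also have "\<dots> = (pi * pi * (2*c+1) + 2 * pi * (2*c+1)) * e"
    by (simp add: field_simps)
  finally show ?thesis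
    unfolding sphere_defect_def
    by (intro order_trans[OF abs_triangle_ineq4]) (simp only: abs_mult abs_of_nonneg[OF pi_ge_zero])
qed

lemma sphere_defect_eq_0:
  assumes "continuous_on {-1..1} G" "c \<ge> 0"
  shows "sphere_defect c G = 0"
proof (rule ccontr)
  define K where "K = pi * pi * (2*c+1) + 2 * pi * (2*c+1)"
  assume n: "sphere_defect c G \<noteq> 0"
  have K: "K > 0" unfolding K_def using assms(2) by (intro add_pos_pos mult_pos_pos add_nonneg_pos) auto
  define e where "e = \<bar>sphere_defect c G\<bar> / (2 * K)"
  have e: "e > 0" using n K by (simp add: e_def)
  obtain h where h: "real_polynomial_function h" "\<And>z. z \<in> {-1..1} \<Longrightarrow> \<bar>G z - h z\<bar> < e"
    using Stone_Weierstrass_real_polynomial_function[of "{-1..1::real}" G e] assms e by auto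
  then obtain a n where h_eq: "h = (\<lambda>x. \<Sum>i\<le>n. a i * x^i)"
    using real_polynomial_function_iff_sum by blast
  have h_cont: "continuous_on {-1..1} h" unfolding h_eq by (intro continuous_intros)
  have "sphere_defect c h = (\<Sum>i\<le>n. a i * sphere_defect c (\<lambda>x. x^i))"
    unfolding h_eq by (rule sphere_defect_sum) (auto intro!: continuous_intros)
  then have "sphere_defect c h = 0" by (simp add: sphere_defect_power)
  then have "sphere_defect c G = sphere_defect c (\<lambda>z. G z - h z)"
    by (simp add: sphere_defect_diff assms h_cont)
  moreover have "\<bar>sphere_defect c (\<lambda>z. G z - h z)\<bar> \<le> K * e"
    unfolding K_def
  proof (rule abs_sphere_defect_le)
    show "\<bar>G z - h z\<bar> \<le> e" if "\<bar>z\<bar> \<le> 1" for z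
    proof -
      have "z \<in> {-1..1}" using that by auto
      from h(2)[OF this] show ?thesis by (rule less_imp_le)
    qed
  qed (auto intro!: continuous_intros assms h_cont)
  moreover have "K * e = \<bar>sphere_defect c G\<bar> / 2" using K by (simp add: e_def)
  ultimately show False using n by linarith
qed

text \<open>Let H be the even part of G, up to a factor 2. Applied to the dilations G (x z), the identity
sphere_defect_eq_0 turns the hypothesis into (n+1) M x = n x K x, where K and M are the primitives of
H z and z * H z that vanish at 0. Differentiating yields r H r = n K r, so K is a multiple of
r^n and H a multiple of r^(n-1).\<close>

lemma even_part_eq_power_if_circle_integral_0:
  assumes cont: "continuous_on {-1..1} G"
    and zero: "\<And>s. s \<in> {0..1} \<Longrightarrow> circle_integral (real n) G s = 0"
    and n: "n \<ge> 1" and r: "r \<in> {0<..1}"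
  shows "G r + G (-r) = (G 1 + G (-1)) * r ^ (n - 1)"
proof -
  define H where "H z = G z + G (-z)" for z
  have H: "continuous_on {0..1} H" unfolding H_def
    by (intro continuous_intros continuous_on_compose2[OF cont]) auto
  define K where "K r = integral {0..r} H" for r
  have key: "r * H r = n * K r" if r: "r \<in> {0<..1}" for r
  proof -
    define M where "M r = integral {0..r} (\<lambda>z. z * H z)" for r
    have M: "(real n+1) * M x = real n * x * K x" if x: "x \<in> {0<..1}" for x
    proof -
      let ?G = "\<lambda>z. G (x * z)"
      have "circle_integral (real n) ?G s = circle_integral (real n) G (x * s)" for s
        by (simp add: circle_integral_def mult_ac)
      moreover have "x * sin b \<in> {0..1}" if "b \<in> {0..pi/2}" for b
        using x that sin_ge_zero[of b] by (auto intro: mult_le_one)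
      ultimately have "integral {0..pi/2} (\<lambda>b. sin b * circle_integral (real n) ?G (sin b)) = integral {0..pi/2} (\<lambda>b. 0)"
        by (intro integral_cong) (simp add: zero)
      moreover have "x * z \<in> {-1..1}" if "z \<in> {-1..1}" for z
        using times_cos_in_Icc[of x "arccos z"] x that by auto
      then have "continuous_on {-1..1} ?G"
        by (intro continuous_on_compose2[OF cont]) (auto intro!: continuous_intros)
      ultimately have "integral {0..1} (\<lambda>z. H (x * z) * ((real n+1) * z - real n)) = 0"
        using sphere_defect_eq_0[of ?G "real n"] unfolding sphere_defect_def H_def by simp
      moreover have "((\<lambda>z. H z * ((real n+1) * z - real n * x)) has_integral ((real n+1) * M x - real n * x * K x)) {0..x}"
      proof -
        have sub: "continuous_on {0..x} H" using H by (rule continuous_on_subset) (use x in auto)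
        have 1: "((\<lambda>z. z * H z) has_integral M x) {0..x}" unfolding M_def
          by (intro integrable_integral integrable_continuous_real continuous_intros sub)
        have 2: "(H has_integral K x) {0..x}" unfolding K_def
          by (intro integrable_integral integrable_continuous_real continuous_intros sub)
        show ?thesis
          using has_integral_diff[OF has_integral_mult_right[OF 1, of "real n+1"] has_integral_mult_right[OF 2, of "real n*x"]]
          by (simp add: algebra_simps)
      qed
      from has_integral_stretch_real[OF this, of x] x
      have "((\<lambda>z. H (x * z) * ((real n+1) * (x * z) - real n * x)) has_integral ((real n+1) * M x - real n * x * K x) / x) {0..1}"
        by simp
      then have "((\<lambda>z. x * (H (x * z) * ((real n+1) * z - real n))) has_integral ((real n+1) * M x - real n * x * K x) / x) {0..1}"
        by (rule has_integral_eq[rotated]) (simp add: algebra_simps)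
      from integral_unique[OF this]
      have "x * integral {0..1} (\<lambda>z. H (x * z) * ((real n+1) * z - real n)) = ((real n+1) * M x - real n * x * K x) / x"
        by (simp only: integral_mult_right)
      ultimately show ?thesis using x by simp
    qed
    have r': "r \<in> {0..1}" using r by auto
    have K': "(K has_real_derivative H r) (at r within {0..1})"
      unfolding K_def by (rule integral_has_real_derivative[OF H r'])
    have M': "(M has_real_derivative r * H r) (at r within {0..1})"
      unfolding M_def by (rule integral_has_real_derivative[OF _ r']) (intro continuous_intros H)
    have "((\<lambda>x. (real n+1) * M x) has_real_derivative (real n+1) * (r * H r)) (at r within {0<..1})"
      by (intro DERIV_cmult DERIV_subset[OF M']) auto
    moreover have "((\<lambda>x. real n * x * K x) has_real_derivative (n * r * H r + n * K r)) (at r within {0<..1})"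
      by (rule derivative_eq_intros DERIV_subset[OF K'] refl | force)+
    then have "((\<lambda>x. (real n+1) * M x) has_real_derivative (n * r * H r + n * K r)) (at r within {0<..1})"
      unfolding has_real_derivative_iff_has_vector_derivative
      by (rule has_vector_derivative_transform[OF r, rotated]) (simp only: M)
    moreover have "at r within {0<..1} \<noteq> bot"
      using r islimpt_Ioc[of 0 1 r] by (simp add: trivial_limit_within)
    ultimately have "(real n+1) * (r * H r) = n * r * H r + n * K r"
      using vector_derivative_unique_within[of r "{0<..1}"] by (auto simp: has_real_derivative_iff_has_vector_derivative)
    then show ?thesis by (simp add: algebra_simps)
  qed
  have deriv: "((\<lambda>x. K x / x ^ n) has_real_derivative 0) (at x within {0<..1})" if x: "x \<in> {0<..1}" for x
  proof -
    have K': "(K has_real_derivative H x) (at x within {0<..1})"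
      unfolding K_def by (rule DERIV_subset[OF integral_has_real_derivative[OF H]]) (use x in auto)
    have "n * K x * x ^ (n-1) = H x * x ^ n"
      using key[OF x] n by (cases n) (auto simp: mult_ac)
    then show ?thesis
      by (auto intro!: derivative_eq_intros K' simp: mult_ac)  (use x in auto)
  qed
  have "K r / r ^ n = K 1 / 1 ^ n"
    using has_field_derivative_zero_constant[OF convex_real_interval(6) deriv] r
    by (metis (no_types, lifting) zero_less_one greaterThanAtMost_iff order_refl)
  then have "n * K r = r ^ n * (n * K 1)" using r by (simp add: field_simps)
  then have "r * H r = r ^ n * H 1"
    using key[OF r] key[of 1] by simp
  also have "r ^ n = r * r ^ (n-1)" using n by (simp add: power_eq_if)
  finally show ?thesis using r by (simp add: H_def mult_ac)
qed

section \<open>Averages over the circles of latitude\<close>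

definition orthonormal_triple :: "'a::euclidean_space \<Rightarrow> 'a \<Rightarrow> 'a \<Rightarrow> bool" where
  "orthonormal_triple p u v \<longleftrightarrow>
     norm p = 1 \<and> norm u = 1 \<and> norm v = 1 \<and> p \<bullet> u = 0 \<and> p \<bullet> v = 0 \<and> u \<bullet> v = 0"

lemma orthonormal_triple_inner:
  assumes "orthonormal_triple p u v"
  shows "p \<bullet> p = 1" "u \<bullet> u = 1" "v \<bullet> v = 1" "p \<bullet> u = 0" "p \<bullet> v = 0" "u \<bullet> v = 0"
    "u \<bullet> p = 0" "v \<bullet> p = 0" "v \<bullet> u = 0"
  using assms by (auto simp: orthonormal_triple_def norm_eq_1 inner_commute)

lemma norm_latitude:
  assumes "orthonormal_triple p u v" "z \<in> {-1..1}"
  shows "norm (z *\<^sub>R p + sqrt (1 - z\<^sup>2) *\<^sub>R (cos t *\<^sub>R u + sin t *\<^sub>R v)) = 1"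
proof -
  have "z\<^sup>2 \<le> 1" using assms(2) by (auto simp: abs_square_le_1 abs_le_iff)
  moreover define r where "r = sqrt (1 - z\<^sup>2)"
  ultimately have "r * r = 1 - z * z" by (simp add: power2_eq_square)
  have "(z *\<^sub>R p + r *\<^sub>R (cos t *\<^sub>R u + sin t *\<^sub>R v)) \<bullet> (z *\<^sub>R p + r *\<^sub>R (cos t *\<^sub>R u + sin t *\<^sub>R v))
      = z * z + r * r * (cos t * cos t + sin t * sin t)"
    by (simp add: inner_add_left inner_add_right orthonormal_triple_inner[OF assms(1)] algebra_simps
        del: sin_cos_squared_add3)
  also have "\<dots> = 1" using \<open>r * r = 1 - z * z\<close> by simp
  finally show ?thesis unfolding norm_eq_1 r_def .
qed

lemma exists_polar_angle:
  assumes "a\<^sup>2 + b\<^sup>2 = \<rho>\<^sup>2" "\<rho> \<ge> 0"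
  obtains \<alpha> where "0 \<le> \<alpha>" "\<alpha> \<le> 2*pi" "a = \<rho> * cos \<alpha>" "b = \<rho> * sin \<alpha>"
proof (cases "\<rho> = 0")
  case True
  then show ?thesis using assms that[of 0] by (simp add: sum_power2_eq_zero_iff)
next
  case False
  then have "(a / \<rho>)\<^sup>2 + (b / \<rho>)\<^sup>2 = 1" using assms(1)
    by (simp add: power_divide flip: add_divide_distrib)
  then obtain \<alpha> where "0 \<le> \<alpha>" "\<alpha> < 2*pi" "a / \<rho> = cos \<alpha>" "b / \<rho> = sin \<alpha>"
    using sincos_total_2pi by metis
  with False that[of \<alpha>] show ?thesis by (simp add: field_simps)
qed

definition latitude_integral :: "('a::euclidean_space \<Rightarrow> real) \<Rightarrow> 'a \<Rightarrow> 'a \<Rightarrow> 'a \<Rightarrow> real \<Rightarrow> real" where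
  "latitude_integral f p u v z =
     integral {0..2*pi} (\<lambda>\<theta>. f (z *\<^sub>R p + sqrt (1 - z\<^sup>2) *\<^sub>R (cos \<theta> *\<^sub>R u + sin \<theta> *\<^sub>R v)))"

lemma continuous_on_latitude_integral:
  assumes f: "continuous_on (sphere 0 1) f" and onb: "orthonormal_triple p u v"
  shows "continuous_on {-1..1} (latitude_integral f p u v)"
proof -
  have "continuous_on ({-1..1} \<times> cbox 0 (2*pi))
     (\<lambda>x. f (fst x *\<^sub>R p + sqrt (1 - (fst x)\<^sup>2) *\<^sub>R (cos (snd x) *\<^sub>R u + sin (snd x) *\<^sub>R v)))"
  proof (rule continuous_on_compose2[OF f])
    show "(\<lambda>x. fst x *\<^sub>R p + sqrt (1 - (fst x)\<^sup>2) *\<^sub>R (cos (snd x) *\<^sub>R u + sin (snd x) *\<^sub>R v))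
       ` ({-1..1} \<times> cbox 0 (2*pi)) \<subseteq> sphere 0 1"
      using norm_latitude[OF onb] by auto
  qed (intro continuous_intros)
  then show ?thesis
    using integral_continuous_on_param[of "{-1..1}" 0 "2*pi"
       "\<lambda>z \<theta>. f (z *\<^sub>R p + sqrt (1 - z\<^sup>2) *\<^sub>R (cos \<theta> *\<^sub>R u + sin \<theta> *\<^sub>R v))"]
    by (simp add: latitude_integral_def[abs_def] split_def)
qed

text \<open>The orbit of any point at height z under the rotations about p is the circle of latitude at that
height; the starting point of the orbit only shifts the angle.\<close>

lemma latitude_integral_rotate:
  assumes f: "continuous_on (sphere 0 1) f" and onb: "orthonormal_triple p u v"
    and z: "z \<in> {-1..1}" and ab: "a\<^sup>2 + b\<^sup>2 = 1 - z\<^sup>2"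
  shows "integral {0..2*pi} (\<lambda>\<theta>. f (z *\<^sub>R p + a *\<^sub>R (cos \<theta> *\<^sub>R u + sin \<theta> *\<^sub>R v)
            + b *\<^sub>R (- sin \<theta> *\<^sub>R u + cos \<theta> *\<^sub>R v))) = latitude_integral f p u v z"
proof -
  define \<rho> where "\<rho> = sqrt (1 - z\<^sup>2)"
  have "1 - z\<^sup>2 \<ge> 0" using z by (auto simp: abs_square_le_1 abs_le_iff)
  then have "a\<^sup>2 + b\<^sup>2 = \<rho>\<^sup>2" "\<rho> \<ge> 0" using ab by (auto simp: \<rho>_def)
  then obtain \<alpha> where \<alpha>: "0 \<le> \<alpha>" "\<alpha> \<le> 2*pi" "a = \<rho> * cos \<alpha>" "b = \<rho> * sin \<alpha>"
    by (rule exists_polar_angle)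
  define h where "h \<theta> = f (z *\<^sub>R p + \<rho> *\<^sub>R (cos \<theta> *\<^sub>R u + sin \<theta> *\<^sub>R v))" for \<theta>
  have "z *\<^sub>R p + a *\<^sub>R (cos \<theta> *\<^sub>R u + sin \<theta> *\<^sub>R v) + b *\<^sub>R (- sin \<theta> *\<^sub>R u + cos \<theta> *\<^sub>R v)
     = z *\<^sub>R p + \<rho> *\<^sub>R (cos (\<alpha> + \<theta>) *\<^sub>R u + sin (\<alpha> + \<theta>) *\<^sub>R v)" for \<theta>
    unfolding \<alpha>(3,4) by (simp add: cos_add sin_add algebra_simps)
  then have "integral {0..2*pi} (\<lambda>\<theta>. f (z *\<^sub>R p + a *\<^sub>R (cos \<theta> *\<^sub>R u + sin \<theta> *\<^sub>R v)
            + b *\<^sub>R (- sin \<theta> *\<^sub>R u + cos \<theta> *\<^sub>R v))) = integral {0..2*pi} (\<lambda>\<theta>. h (\<alpha> + \<theta>))"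
    unfolding h_def by (simp only:)
  also have "\<dots> = integral {0..2*pi} h"
  proof (rule integral_periodic_shift)
    show "continuous_on UNIV h" unfolding h_def \<rho>_def
      by (rule continuous_on_compose2[OF f])
         (use norm_latitude[OF onb z] in \<open>auto intro!: continuous_intros\<close>)
  qed (use \<alpha> in \<open>auto simp: h_def\<close>)
  finally show ?thesis unfolding latitude_integral_def h_def \<rho>_def .
qed

text \<open>For fixed \<theta>, the points cos t A \<theta> + sin t B \<theta> of the proof run through a great circle with
highest point A \<theta> at height s. By the previous lemma, integrating f over \<theta> leaves its mean at height
s cos t; exchanging the integrals shows that the coefficients of frequency 2 and 3 of this mean vanish.\<close>

lemma latitude_integral_affine:
  assumes f: "continuous_on (sphere 0 1) f" and onb: "orthonormal_triple p u v"
    and circ: "\<And>A B k. \<lbrakk>norm A = 1; norm B = 1; A \<bullet> B = 0; k = 2 \<or> k = 3\<rbrakk> \<Longrightarrow>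
       integral {0..2*pi} (\<lambda>t. f (cos t *\<^sub>R A + sin t *\<^sub>R B) * cos (real k * t)) = 0"
    and z: "z \<in> {-1..1}"
  shows "latitude_integral f p u v z = pi * (f p + f (-p)) + pi * (f p - f (-p)) * z"
proof -
  define g where "g = latitude_integral f p u v"
  note g_cont = continuous_on_latitude_integral[OF f onb, folded g_def]
  have zero: "integral {0..2*pi} (\<lambda>t. g (s * cos t) * cos (real k * t)) = 0"
    if s: "s \<in> {0..1}" and k: "k = 2 \<or> k = 3" for s k
  proof -
    define \<sigma> where "\<sigma> = sqrt (1 - s\<^sup>2)"
    have "1 - s\<^sup>2 \<ge> 0" using s by (auto simp: abs_square_le_1 abs_le_iff)
    then have \<sigma>: "\<sigma>\<^sup>2 = 1 - s\<^sup>2" by (simp add: \<sigma>_def)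
    define A where "A \<theta> = s *\<^sub>R p + \<sigma> *\<^sub>R (cos \<theta> *\<^sub>R u + sin \<theta> *\<^sub>R v)" for \<theta>
    define B where "B \<theta> = - sin \<theta> *\<^sub>R u + cos \<theta> *\<^sub>R v" for \<theta>
    have sc: "cos \<theta> * cos \<theta> + sin \<theta> * sin \<theta> = 1" for \<theta> :: real by (simp flip: power2_eq_square)
    have AB: "norm (A \<theta>) = 1" "norm (B \<theta>) = 1" "A \<theta> \<bullet> B \<theta> = 0" for \<theta>
    proof -
      show "norm (A \<theta>) = 1" unfolding A_def \<sigma>_def by (rule norm_latitude[OF onb]) (use s in auto)
      show "norm (B \<theta>) = 1" "A \<theta> \<bullet> B \<theta> = 0"
        using sc[of \<theta>]
        by (simp_all add: norm_eq_1 A_def B_def inner_add_left inner_add_right inner_diff_left inner_diff_right orthonormal_triple_inner[OF onb] algebra_simps)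
    qed
    have norm1: "norm (cos t *\<^sub>R A \<theta> + sin t *\<^sub>R B \<theta>) = 1" for t \<theta>
      using AB[of \<theta>] sc[of t]
      by (simp add: norm_eq_1 inner_add_left inner_add_right inner_commute[of "B \<theta>" "A \<theta>"])
    have "g (s * cos t) = integral {0..2*pi} (\<lambda>\<theta>. f (cos t *\<^sub>R A \<theta> + sin t *\<^sub>R B \<theta>))" for t
    proof -
      have ab: "(\<sigma> * cos t)\<^sup>2 + (sin t)\<^sup>2 = 1 - (s * cos t)\<^sup>2"
        unfolding power_mult_distrib \<sigma> using sin_cos_squared_add[of t] by algebra
      have "(s * cos t)\<^sup>2 \<le> 1" using ab by (metis diff_ge_0_iff_ge sum_power2_ge_zero)
      then have "s * cos t \<in> {-1..1}" by (simp add: abs_square_le_1 abs_le_iff) 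
      from latitude_integral_rotate[OF f onb this ab]
      have "g (s * cos t) = integral {0..2*pi} (\<lambda>\<theta>. f ((s * cos t) *\<^sub>R p
          + (\<sigma> * cos t) *\<^sub>R (cos \<theta> *\<^sub>R u + sin \<theta> *\<^sub>R v) + sin t *\<^sub>R B \<theta>))"
        unfolding g_def B_def by (rule sym)
      moreover have "cos t *\<^sub>R A \<theta> = (s * cos t) *\<^sub>R p
          + (\<sigma> * cos t) *\<^sub>R (cos \<theta> *\<^sub>R u + sin \<theta> *\<^sub>R v)" for \<theta>
        unfolding A_def by (simp add: scaleR_add_right mult_ac)
      ultimately show ?thesis by (simp only:)
    qed
    then have "integral {0..2*pi} (\<lambda>t. g (s * cos t) * cos (real k * t)) =
        integral {0..2*pi} (\<lambda>t. integral {0..2*pi} (\<lambda>\<theta>. f (cos t *\<^sub>R A \<theta> + sin t *\<^sub>R B \<theta>) * cos (real k * t)))"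
      by simp
    also have "\<dots> = integral {0..2*pi} (\<lambda>\<theta>. integral {0..2*pi} (\<lambda>t. f (cos t *\<^sub>R A \<theta> + sin t *\<^sub>R B \<theta>) * cos (real k * t)))"
    proof -
      have "continuous_on (cbox (0,0) (2*pi,2*pi)) (\<lambda>x. f (cos (fst x) *\<^sub>R A (snd x) + sin (fst x) *\<^sub>R B (snd x)))"
        by (rule continuous_on_compose2[OF f])
           (auto simp: norm1, auto simp: A_def B_def intro!: continuous_intros)
      then have "continuous_on (cbox (0,0) (2*pi,2*pi))
         (\<lambda>(t,\<theta>). f (cos t *\<^sub>R A \<theta> + sin t *\<^sub>R B \<theta>) * cos (real k * t))"
        unfolding split_def by (intro continuous_intros)
      from integral_swap_continuous[OF this] show ?thesis by simp
    qed
    also have "\<dots> = 0" using circ[OF AB k] by simp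
    finally show ?thesis .
  qed
  have even: "g z + g (-z) = g 1 + g (-1)" if z: "z \<in> {0<..1}" for z
  proof -
    have "circle_integral (real 1) g s = 0" if "s \<in> {0..1}" for s
      using zero[OF that, of 2] by (simp add: circle_integral_def cos_double_cos)
    from even_part_eq_power_if_circle_integral_0[OF g_cont this _ z] show ?thesis by simp
  qed
  have odd: "g z - g (-z) = (g 1 - g (-1)) * z" if z: "z \<in> {0<..1}" for z
  proof -
    have "circle_integral (real 3) (\<lambda>z. z * g z) s = 0" if "s \<in> {0..1}" for s
    proof -
      have "circle_integral (real 3) (\<lambda>z. z * g z) s = integral {0..2*pi} (\<lambda>t. s * (g (s * cos t) * cos (3 * t)))"
        unfolding circle_integral_def
        by (intro integral_cong, subst cos_treble_cos)
           (simp add: power2_eq_square power3_eq_cube algebra_simps)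
      then show ?thesis using zero[OF that, of 3] by simp
    qed
    from even_part_eq_power_if_circle_integral_0[OF continuous_on_mult[OF continuous_on_id g_cont] this _ z]
    have "z * g z + (-z) * g (-z) = (1 * g 1 + (-1) * g (-1)) * z ^ 2"
      by simp
    then have "z * (g z - g (-z)) = z * ((g 1 - g (-1)) * z)" by (simp add: power2_eq_square algebra_simps)
    then show ?thesis using z by simp
  qed
  have g1: "g 1 = 2 * pi * f p" "g (-1) = 2 * pi * f (-p)"
    by (simp_all add: g_def latitude_integral_def)
  define \<alpha> where "\<alpha> = pi * (f p + f (-p))"
  define \<beta> where "\<beta> = pi * (f p - f (-p))"
  have pos: "g z = \<alpha> + \<beta> * z" and neg: "g (-z) = \<alpha> - \<beta> * z" if z: "z \<in> {0<..1}" for z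
  proof -
    have "2 * g z = 2 * (\<alpha> + \<beta> * z)" "2 * g (-z) = 2 * (\<alpha> - \<beta> * z)"
      using even[OF z] odd[OF z] unfolding g1 \<alpha>_def \<beta>_def by algebra+
    then show "g z = \<alpha> + \<beta> * z" "g (-z) = \<alpha> - \<beta> * z" by auto
  qed
  \<comment> \<open>The integral equation only yields nonzero heights; the equator follows by continuity.\<close>
  have "g 0 - (\<alpha> + \<beta> * 0) = 0"
  proof (rule continuous_constant_on_closure[of "{0<..1}" "\<lambda>z. g z - (\<alpha> + \<beta> * z)"])
    show "continuous_on (closure {0<..1}) (\<lambda>z. g z - (\<alpha> + \<beta> * z))"
      by (intro continuous_intros continuous_on_subset[OF g_cont]) auto
  qed (use pos in auto)
  then have "g z = \<alpha> + \<beta> * z"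
    using pos[of z] neg[of "-z"] z by (cases z "0::real" rule: linorder_cases) auto
  then show ?thesis unfolding g_def \<alpha>_def \<beta>_def .
qed

section \<open>Functions on the two-dimensional sphere\<close>

lemma orthonormal_triple_extend:
  fixes x y :: "'a::euclidean_space"
  assumes "DIM('a) \<ge> 3" "norm x = 1"
  obtains u v where "orthonormal_triple x u v" "y = (x \<bullet> y) *\<^sub>R x + (u \<bullet> y) *\<^sub>R u"
proof -
  have xx: "x \<bullet> x = 1" using assms(2) by (simp add: norm_eq_1)
  obtain u where u: "norm u = 1" "x \<bullet> u = 0" "y = (x \<bullet> y) *\<^sub>R x + (u \<bullet> y) *\<^sub>R u"
  proof (cases "y = (x \<bullet> y) *\<^sub>R x")
    case True
    obtain w where w: "w \<noteq> 0" "orthogonal x w"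
      using orthogonal_to_vector_exists[of x] assms(1) by auto
    have "(w /\<^sub>R norm w) \<bullet> y = 0"
      by (subst True) (use w(2) in \<open>simp add: orthogonal_def inner_commute\<close>)
    with w True that[of "w /\<^sub>R norm w"] show ?thesis by (simp add: orthogonal_def)
  next
    case False
    define r where "r = y - (x \<bullet> y) *\<^sub>R x"
    have r: "norm r \<noteq> 0" "x \<bullet> r = 0" using False by (auto simp: r_def inner_diff_right xx)
    then have "r \<bullet> y = (norm r)\<^sup>2"
      by (simp add: r_def power2_norm_eq_inner inner_diff_right inner_diff_left xx inner_commute)
    then have "(r /\<^sub>R norm r) \<bullet> y = norm r" using r by (simp add: power2_eq_square)
    then show ?thesis using r that[of "r /\<^sub>R norm r"] by (simp add: r_def)
  qed
  have "dim {x, u} < DIM('a)"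
    using dim_le_card'[of "{x,u}"] card_insert_le_m1[of 2 "{u}" x] assms(1) by auto
  then obtain w where w: "w \<noteq> 0" "\<And>y. y \<in> span {x,u} \<Longrightarrow> orthogonal w y"
    using orthogonal_to_subspace_exists by blast
  have "w \<bullet> x = 0" "w \<bullet> u = 0" using w(2)[of x] w(2)[of u] by (auto simp: span_base orthogonal_def)
  then have "orthonormal_triple x u (w /\<^sub>R norm w)"
    using u w(1) assms(2) by (auto simp: orthonormal_triple_def inner_commute)
  then show ?thesis using that u by blast
qed

lemma orthonormal_triple_expansion:
  fixes p u v :: "real^3"
  assumes "orthonormal_triple p u v"
  shows "x = (p \<bullet> x) *\<^sub>R p + (u \<bullet> x) *\<^sub>R u + (v \<bullet> x) *\<^sub>R v"
proof (rule ccontr)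
  note inn = orthonormal_triple_inner[OF assms]
  define r where "r = x - ((p \<bullet> x) *\<^sub>R p + (u \<bullet> x) *\<^sub>R u + (v \<bullet> x) *\<^sub>R v)"
  assume "\<not> ?thesis"
  then have r: "r \<noteq> 0" by (simp add: r_def)
  have orth: "p \<bullet> r = 0" "u \<bullet> r = 0" "v \<bullet> r = 0"
    by (simp_all add: r_def inner_diff_right inner_add_right inn)
  have "r \<bullet> r \<noteq> 0" using r by simp
  then have ne: "p \<noteq> u" "p \<noteq> v" "u \<noteq> v" "r \<noteq> p" "r \<noteq> u" "r \<noteq> v" using inn orth by auto
  have "independent {r, p, u, v}"
    using orth inn r
    by (intro pairwise_orthogonal_independent) (auto simp: pairwise_def orthogonal_def inner_commute)
  then have "card {r, p, u, v} \<le> DIM(real^3)" by (rule independent_card_le)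
  then show False using ne by simp
qed

lemma integral_orthogonal_transformation:
  fixes h :: "real^'n::{finite,wellorder} \<Rightarrow> real" and T :: "real^'n::_ \<Rightarrow> real^'n::_"
  assumes T: "orthogonal_transformation T" and h: "h absolutely_integrable_on UNIV"
  shows "integral UNIV (\<lambda>x. h (T x)) = integral UNIV h"
proof -
  have lin: "linear T" and surj: "T ` UNIV = UNIV"
    using orthogonal_transformation_linear[OF T] orthogonal_transformation_surj[OF T] by auto
  have det: "\<bar>det (matrix T)\<bar> = 1"
    using T orthogonal_transformation_matrix det_orthogonal_matrix by (metis abs_1 abs_neg_one)
  have "(\<lambda>x. vec (h x) :: real^1) absolutely_integrable_on UNIV \<and> integral UNIV (\<lambda>x. vec (h x) :: real^1) = vec (integral UNIV h)"
    using h by (simp add: absolutely_integrable_on_1_iff integral_on_1_eq)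
  then have "(\<lambda>x. \<bar>det (matrix T)\<bar> *\<^sub>R (vec (h (T x)) :: real^1)) absolutely_integrable_on UNIV \<and>
     integral UNIV (\<lambda>x. \<bar>det (matrix T)\<bar> *\<^sub>R (vec (h (T x)) :: real^1)) = vec (integral UNIV h)"
    unfolding has_absolute_integral_change_of_variables_linear[OF lin, of UNIV "\<lambda>x. vec (h x) :: real^1"] surj .
  then show ?thesis
    by (simp add: det integral_on_1_eq vec_eq_iff)
qed

lemma norm_less_1_imp_in_cube:
  fixes x :: "real^'n"
  assumes "norm x < 1"
  shows "x \<in> cbox (-1) 1"
proof -
  have "\<bar>x $ i\<bar> \<le> 1" for i using component_le_norm_cart[of x i] assms by linarith
  then show ?thesis by (simp add: mem_box_cart abs_le_iff minus_le_iff)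
qed

lemma integral_over_support:
  fixes h :: "real^'n \<Rightarrow> 'b::euclidean_space"
  assumes cont: "continuous_on UNIV h" and supp: "\<And>x. norm x \<ge> 1 \<Longrightarrow> h x = 0"
  shows "h absolutely_integrable_on UNIV" "integral UNIV h = integral (cbox (-1) 1) h"
proof -
  have sub: "h x = 0" if "x \<notin> cbox (-1) 1" for x
  proof -
    have "norm x \<ge> 1" using that norm_less_1_imp_in_cube[of x] by linarith
    then show ?thesis by (rule supp)
  qed
  have restr: "(\<lambda>x. if x \<in> cbox (-1) 1 then h x else 0) = h" using sub by auto
  have "h absolutely_integrable_on cbox (-1) 1"
    by (rule absolutely_integrable_continuous) (rule continuous_on_subset[OF cont], simp)
  then show "h absolutely_integrable_on UNIV"
    using absolutely_integrable_restrict_UNIV[of "cbox (-1) 1" h] unfolding restr by simp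
  show "integral UNIV h = integral (cbox (-1) 1) h"
    using integral_restrict_UNIV[of "cbox (-1) 1" h] unfolding restr by simp
qed

definition rotate_about :: "'a::euclidean_space \<Rightarrow> 'a \<Rightarrow> 'a \<Rightarrow> real \<Rightarrow> 'a \<Rightarrow> 'a" where
  "rotate_about p u v \<theta> x = (p \<bullet> x) *\<^sub>R p + (u \<bullet> x) *\<^sub>R (cos \<theta> *\<^sub>R u + sin \<theta> *\<^sub>R v)
            + (v \<bullet> x) *\<^sub>R (- sin \<theta> *\<^sub>R u + cos \<theta> *\<^sub>R v)"

lemma orthogonal_transformation_rotate_about:
  fixes p u v :: "real^3"
  assumes "orthonormal_triple p u v"
  shows "orthogonal_transformation (rotate_about p u v \<theta>)"
proof -
  note inn = orthonormal_triple_inner[OF assms]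
  have "linear (rotate_about p u v \<theta>)"
    by (rule linearI) (simp_all add: rotate_about_def inner_add_right algebra_simps)
  moreover have "rotate_about p u v \<theta> x \<bullet> rotate_about p u v \<theta> y = x \<bullet> y" for x y
  proof -
    have "rotate_about p u v \<theta> x \<bullet> rotate_about p u v \<theta> y
       = (p \<bullet> x) * (p \<bullet> y) + ((u \<bullet> x) * (u \<bullet> y) + (v \<bullet> x) * (v \<bullet> y)) * (cos \<theta> * cos \<theta> + sin \<theta> * sin \<theta>)"
      by (simp add: rotate_about_def inner_add_left inner_add_right inner_diff_left inner_diff_right inn algebra_simps
          del: sin_cos_squared_add3)
    also have "\<dots> = x \<bullet> y"
      using arg_cong[OF orthonormal_triple_expansion[OF assms, of x], of "\<lambda>w. w \<bullet> y"]
      by (simp add: inner_add_left)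
    finally show ?thesis .
  qed
  ultimately show ?thesis by (simp add: orthogonal_transformation_def)
qed

lemma continuous_homogeneous_extension:
  fixes f :: "'a::euclidean_space \<Rightarrow> real"
  assumes f: "continuous_on (sphere 0 1) f"
  shows "continuous_on UNIV (\<lambda>x. norm x * f (x /\<^sub>R norm x))"
proof -
  have "isCont (\<lambda>x. norm x * f (x /\<^sub>R norm x)) x" for x
  proof (cases "x = 0")
    case False
    have "continuous_on (-{0}) (\<lambda>x. norm x * f (x /\<^sub>R norm x))"
      by (intro continuous_intros continuous_on_compose2[OF f]) (auto simp: field_simps split: if_splits)
    then show ?thesis using False continuous_on_eq_continuous_at[of "-{0::'a}"] by auto
  next
    case True
    have "compact (f ` sphere 0 1)" by (intro compact_continuous_image f) simp
    then obtain M where M: "\<And>x. norm x = 1 \<Longrightarrow> \<bar>f x\<bar> \<le> M"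
      using compact_imp_bounded by (fastforce simp: bounded_iff)
    have "((\<lambda>x. norm x * f (x /\<^sub>R norm x)) \<longlongrightarrow> 0) (at 0)"
    proof (rule Lim_null_comparison)
      show "\<forall>\<^sub>F x in at 0. norm (norm x * f (x /\<^sub>R norm x)) \<le> norm x * M"
        unfolding eventually_at
        by (intro exI[of _ 1]) (auto simp: abs_mult intro!: mult_left_mono M)
      show "((\<lambda>x. norm x * M) \<longlongrightarrow> 0) (at (0::'a))"
        by (auto intro!: tendsto_eq_intros)
    qed
    then show ?thesis using True by (simp add: isCont_def)
  qed
  then show ?thesis by (simp add: continuous_on_eq_continuous_at)
qed

text \<open>The extension F of f is weighted by the radial factor W x * norm x: the factor norm x makes it
continuous at the origin, and W cuts it off outside the unit ball. The numbers N and \<kappa> are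
the integrals by which the two coefficients of the affine average get multiplied; \<kappa> does not depend
on the direction, again by rotation invariance.\<close>

lemma affine_on_sphere_real3:
  fixes f :: "real^3 \<Rightarrow> real"
  assumes f: "continuous_on (sphere 0 1) f"
    and circ: "\<And>A B k. \<lbrakk>norm A = 1; norm B = 1; A \<bullet> B = 0; k = 2 \<or> k = 3\<rbrakk> \<Longrightarrow>
       integral {0..2*pi} (\<lambda>t. f (cos t *\<^sub>R A + sin t *\<^sub>R B) * cos (real k * t)) = 0"
  obtains c a where "\<And>x. norm x = 1 \<Longrightarrow> f x = c + a \<bullet> x"
proof -
  define W where "W x = max 0 (1 - norm x)" for x :: "real^3"
  define F where "F x = W x * (norm x * f (x /\<^sub>R norm x))" for x
  define J :: "(real^3 \<Rightarrow> real) \<Rightarrow> real" where "J = integral UNIV"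
  have W_cont: "continuous_on A W" for A unfolding W_def by (intro continuous_intros)
  have F_cont: "continuous_on UNIV F" unfolding F_def
    by (intro continuous_on_mult W_cont continuous_homogeneous_extension f)
  have W_supp: "W x = 0" if "norm x \<ge> 1" for x using that by (simp add: W_def)
  have F_supp: "F x = 0" if "norm x \<ge> 1" for x using that by (simp add: F_def W_supp)
  have J_inv: "J (\<lambda>x. h (T x)) = J h"
    if "orthogonal_transformation T" "continuous_on UNIV h" "\<And>x. norm x \<ge> 1 \<Longrightarrow> h x = 0" for T h
    unfolding J_def by (intro integral_orthogonal_transformation integral_over_support(1) that)
  have J_odd: "J h = 0" if "continuous_on UNIV h" "\<And>x. norm x \<ge> 1 \<Longrightarrow> h x = 0" "\<And>x. h (-x) = - h x" for h
  proof -
    have "J h = J (\<lambda>x. h (- x))"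
      by (rule J_inv[symmetric]) (use that in \<open>auto simp: orthogonal_transformation_def linear_iff\<close>)
    also have "\<dots> = - J h" unfolding that(3) J_def by simp
    finally show ?thesis by simp
  qed
  have J_pos: "J h \<noteq> 0"
    if "continuous_on UNIV h" "\<And>x. norm x \<ge> 1 \<Longrightarrow> h x = 0" "\<And>x. h x \<ge> 0" "norm x < 1" "h x \<noteq> 0" for h x
  proof -
    have "x \<in> cbox (-1) 1"
      using that(4) by (rule norm_less_1_imp_in_cube)
    moreover have "box (-1) (1::real^3) \<noteq> {}" by (simp add: interval_ne_empty_cart)
    moreover have "continuous_on (cbox (-1) 1) h" using that(1) by (rule continuous_on_subset) simp
    ultimately have "integral (cbox (-1) 1) h \<noteq> 0"
      using integral_cbox_eq_0_iff[of "-1" 1 h] that(3,5) by blast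
    then show ?thesis using integral_over_support(2)[OF that(1,2)] by (simp add: J_def)
  qed
  define N where "N = J (\<lambda>x. W x * norm x)"
  define \<kappa> where "\<kappa> p = J (\<lambda>x. W x * (p \<bullet> x)\<^sup>2)" for p
  have N: "N \<noteq> 0" unfolding N_def
    by (rule J_pos[of _ "(1/2) *\<^sub>R axis 1 1"])
       (auto intro!: continuous_intros W_cont simp: W_supp, auto simp: W_def)
  have \<kappa>: "\<kappa> p \<noteq> 0" if "norm p = 1" for p unfolding \<kappa>_def
    by (rule J_pos[of _ "(1/2) *\<^sub>R p"])
       (use that norm_eq_1[of p] in \<open>auto intro!: continuous_intros W_cont simp: W_supp\<close>, auto simp: W_def)
  have \<kappa>_const: "\<kappa> q = \<kappa> p" if pq: "norm q = 1" "norm p = 1" for p q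
  proof -
    obtain T where T: "orthogonal_transformation T" "T q = p"
      using orthogonal_transformation_exists_1[OF pq] by metis
    have "q \<bullet> x = p \<bullet> T x" and "norm (T x) = norm x" for x
      using T by (auto simp: orthogonal_transformation_def orthogonal_transformation_norm)
    then have "\<kappa> q = J (\<lambda>x. (\<lambda>x. W x * (p \<bullet> x)\<^sup>2) (T x))" by (simp add: \<kappa>_def W_def)
    also have "\<dots> = \<kappa> p" unfolding \<kappa>_def
      by (rule J_inv[OF T(1)]) (auto intro!: continuous_intros W_cont simp: W_supp)
    finally show ?thesis .
  qed
  \<comment> \<open>Rotate F about p by every angle, integrate over the angle, and exchange the integrals.\<close>
  have main: "2 * pi * J (\<lambda>x. F x * \<psi> (p \<bullet> x)) =
      J (\<lambda>x. W x * \<psi> (p \<bullet> x) * (pi * (f p + f (-p)) * norm x + pi * (f p - f (-p)) * (p \<bullet> x)))"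
    if p: "norm p = 1" and \<psi>: "continuous_on UNIV \<psi>" for p \<psi>
  proof -
    obtain u v where onb: "orthonormal_triple p u v"
      by (rule orthonormal_triple_extend[of p p]) (use p in auto)
    define R where "R = rotate_about p u v"
    have R: "orthogonal_transformation (R \<theta>)" for \<theta>
      unfolding R_def by (rule orthogonal_transformation_rotate_about[OF onb])
    have pR: "p \<bullet> R \<theta> x = p \<bullet> x" for \<theta> x
      by (simp add: R_def rotate_about_def inner_add_right inner_diff_right orthonormal_triple_inner[OF onb])
    have R_cont: "continuous_on A (\<lambda>x. R (fst x) (snd x))" for A
      unfolding R_def rotate_about_def by (intro continuous_intros)
    have \<psi>': "continuous_on A (\<lambda>x. \<psi> (p \<bullet> g x))" if "continuous_on A g" for A g
      by (rule continuous_on_compose2[OF \<psi>]) (auto intro!: continuous_intros that)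
    have FR_cont: "continuous_on A (\<lambda>x. F (R (fst x) (snd x)))" for A
      by (rule continuous_on_compose2[OF F_cont R_cont]) auto
    have average: "integral {0..2*pi} (\<lambda>\<theta>. F (R \<theta> x)) =
        W x * (pi * (f p + f (-p)) * norm x + pi * (f p - f (-p)) * (p \<bullet> x))" for x
    proof (cases "x = 0")
      case True
      then show ?thesis by (simp add: R_def rotate_about_def F_def)
    next
      case False
      define y where "y = x /\<^sub>R norm x"
      have y: "norm y = 1" and x: "x = norm x *\<^sub>R y" using False by (auto simp: y_def)
      have z: "p \<bullet> y \<in> {-1..1}" using Cauchy_Schwarz_ineq2[of p y] p y by (simp add: abs_le_iff) 
      have "y \<bullet> y = (p \<bullet> y)\<^sup>2 + (u \<bullet> y)\<^sup>2 + (v \<bullet> y)\<^sup>2"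
        by (subst (1) orthonormal_triple_expansion[OF onb, of y]) (simp add: inner_add_left power2_eq_square)
      then have ab: "(u \<bullet> y)\<^sup>2 + (v \<bullet> y)\<^sup>2 = 1 - (p \<bullet> y)\<^sup>2" using y by (simp add: norm_eq_1)
      have "F (R \<theta> x) = W x * norm x * f (R \<theta> y)" for \<theta>
        using R[of \<theta>] orthogonal_transformation_linear[OF R, of \<theta>]
        by (simp add: F_def W_def orthogonal_transformation_norm y_def linear_cmul)
      then have "integral {0..2*pi} (\<lambda>\<theta>. F (R \<theta> x)) = W x * norm x * latitude_integral f p u v (p \<bullet> y)"
        using latitude_integral_rotate[OF f onb z ab] by (simp add: R_def rotate_about_def)
      also have "\<dots> = W x * norm x * (pi * (f p + f (-p)) + pi * (f p - f (-p)) * (p \<bullet> y))"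
        by (simp add: latitude_integral_affine[OF f onb circ z])
      also have "\<dots> = W x * (pi * (f p + f (-p)) * norm x + pi * (f p - f (-p)) * (p \<bullet> x))"
        using False by (simp add: y_def field_simps)
      finally show ?thesis .
    qed
    have "J (\<lambda>x. F (R \<theta> x) * \<psi> (p \<bullet> x)) = J (\<lambda>x. F x * \<psi> (p \<bullet> x))" for \<theta>
      using J_inv[OF R[of \<theta>], of "\<lambda>x. F x * \<psi> (p \<bullet> x)"] F_cont \<psi>'[OF continuous_on_id] F_supp
      by (simp add: pR continuous_on_mult)
    then have "2 * pi * J (\<lambda>x. F x * \<psi> (p \<bullet> x)) = integral {0..2*pi} (\<lambda>\<theta>. J (\<lambda>x. F (R \<theta> x) * \<psi> (p \<bullet> x)))"
      by simp
    also have "\<dots> = integral {0..2*pi} (\<lambda>\<theta>. integral (cbox (-1) 1) (\<lambda>x. F (R \<theta> x) * \<psi> (p \<bullet> x)))"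
    proof -
      have "continuous_on UNIV (\<lambda>x. F (R \<theta> x))" for \<theta>
        using orthogonal_transformation_linear[OF R]
        by (intro continuous_on_compose2[OF F_cont] linear_continuous_on linear_conv_bounded_linear[THEN iffD1]) auto
      then have "J (\<lambda>x. F (R \<theta> x) * \<psi> (p \<bullet> x)) = integral (cbox (-1) 1) (\<lambda>x. F (R \<theta> x) * \<psi> (p \<bullet> x))" for \<theta>
        unfolding J_def using orthogonal_transformation_norm[OF R]
        by (intro integral_over_support(2) continuous_on_mult \<psi>'[OF continuous_on_id]) (auto simp: F_supp)
      then show ?thesis by simp
    qed
    also have "\<dots> = integral (cbox (-1) 1) (\<lambda>x. integral {0..2*pi} (\<lambda>\<theta>. F (R \<theta> x) * \<psi> (p \<bullet> x)))"
    proof -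
      have "continuous_on (cbox (0,-1) (2*pi,1)) (\<lambda>(\<theta>,x). F (R \<theta> x) * \<psi> (p \<bullet> x))"
        unfolding split_def by (intro continuous_on_mult FR_cont \<psi>' continuous_intros)
      from integral_swap_continuous[OF this] show ?thesis by simp
    qed
    also have "\<dots> = integral (cbox (-1) 1) (\<lambda>x. W x * \<psi> (p \<bullet> x) * (pi * (f p + f (-p)) * norm x + pi * (f p - f (-p)) * (p \<bullet> x)))"
      by (intro integral_cong) (simp only: integral_mult_left average, simp only: mult_ac)
    also have "\<dots> = J (\<lambda>x. W x * \<psi> (p \<bullet> x) * (pi * (f p + f (-p)) * norm x + pi * (f p - f (-p)) * (p \<bullet> x)))"
      unfolding J_def
      by (intro integral_over_support(2)[symmetric] continuous_on_mult W_cont \<psi>'[OF continuous_on_id])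
         (auto intro!: continuous_intros simp: W_supp)
    finally show ?thesis .
  qed
  have J_lin: "J (\<lambda>x. \<alpha> * g x + \<beta> * h x) = \<alpha> * J g + \<beta> * J h"
    if "continuous_on UNIV g" "continuous_on UNIV h" "\<And>x. norm x \<ge> 1 \<Longrightarrow> g x = 0" "\<And>x. norm x \<ge> 1 \<Longrightarrow> h x = 0" for g h \<alpha> \<beta>
  proof -
    have "g integrable_on UNIV" "h integrable_on UNIV"
      using integral_over_support(1) that absolutely_integrable_on_def by blast+
    then show ?thesis unfolding J_def by (subst integral_add) (auto intro: integrable_on_mult_right)
  qed
  define w where "w = integral UNIV (\<lambda>x. F x *\<^sub>R x)"
  have w: "J (\<lambda>x. F x * (p \<bullet> x)) = w \<bullet> p" for p
  proof -
    have "(\<lambda>x. F x *\<^sub>R x) absolutely_integrable_on UNIV"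
      by (rule integral_over_support(1)) (auto intro!: continuous_intros F_cont simp: F_supp)
    then have "(\<lambda>x. F x *\<^sub>R x) integrable_on UNIV" by (simp add: absolutely_integrable_on_def)
    from integral_linear[OF this bounded_linear_inner_right[of p]]
    show ?thesis by (simp add: J_def w_def o_def inner_commute)
  qed
  show ?thesis
  proof (rule that)
    fix p :: "real^3" assume p: "norm p = 1"
    let ?\<alpha> = "pi * (f p + f (-p))" and ?\<beta> = "pi * (f p - f (-p))"
    have z1: "J (\<lambda>x. W x * (p \<bullet> x)) = 0" and z2: "J (\<lambda>x. W x * norm x * (p \<bullet> x)) = 0"
      by (rule J_odd; auto intro!: continuous_intros W_cont simp: W_supp; simp add: W_def)+
    have "2 * pi * J F = J (\<lambda>x. ?\<alpha> * (W x * norm x) + ?\<beta> * (W x * (p \<bullet> x)))"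
      using main[OF p, of "\<lambda>_. 1"] by (simp add: algebra_simps)
    also have "\<dots> = ?\<alpha> * N + ?\<beta> * J (\<lambda>x. W x * (p \<bullet> x))"
      unfolding N_def by (rule J_lin) (auto intro!: continuous_intros W_cont simp: W_supp)
    finally have \<alpha>: "2 * pi * J F = ?\<alpha> * N" using z1 by simp
    have "2 * pi * (w \<bullet> p) = J (\<lambda>x. ?\<alpha> * (W x * norm x * (p \<bullet> x)) + ?\<beta> * (W x * (p \<bullet> x)\<^sup>2))"
      using main[OF p, of "\<lambda>t. t"] unfolding w by (simp add: algebra_simps power2_eq_square)
    also have "\<dots> = ?\<alpha> * J (\<lambda>x. W x * norm x * (p \<bullet> x)) + ?\<beta> * \<kappa> p"
      unfolding \<kappa>_def by (rule J_lin) (auto intro!: continuous_intros W_cont simp: W_supp)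
    also have "\<kappa> p = \<kappa> (axis 1 1)" by (rule \<kappa>_const) (auto simp: p)
    finally have \<beta>: "2 * pi * (w \<bullet> p) = ?\<beta> * \<kappa> (axis 1 1)" using z2 by simp
    have "\<kappa> (axis 1 1) \<noteq> 0" by (rule \<kappa>) simp
    have "pi * (2 * J F) = pi * ((f p + f (-p)) * N)"
      "pi * (2 * (w \<bullet> p)) = pi * ((f p - f (-p)) * \<kappa> (axis 1 1))"
      using \<alpha> \<beta> by (simp_all only: mult_ac)
    then have "2 * J F = (f p + f (-p)) * N" "2 * (w \<bullet> p) = (f p - f (-p)) * \<kappa> (axis 1 1)"
      by simp_all
    with \<open>\<kappa> (axis 1 1) \<noteq> 0\<close> N have "J F / N = (f p + f (-p)) / 2" "(w \<bullet> p) / \<kappa> (axis 1 1) = (f p - f (-p)) / 2"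
      by (auto simp: field_simps split: if_splits)
    then have "f p = J F / N + (w \<bullet> p) / \<kappa> (axis 1 1)" by argo
    then show "f p = J F / N + (w /\<^sub>R \<kappa> (axis 1 1)) \<bullet> p"
      by (simp add: divide_inverse mult.commute)
  qed
qed

section \<open>Gluing along great circles\<close>

text \<open>The third vector v provides a two-dimensional sphere around the great circle through p and u, and the
sphere is identified with the one in the space of coordinate triples.\<close>

lemma affine_on_great_circle:
  fixes f :: "'a::euclidean_space \<Rightarrow> real"
  assumes f: "continuous_on (sphere 0 1) f"
    and circ: "\<And>A B k. \<lbrakk>norm A = 1; norm B = 1; A \<bullet> B = 0; k = 2 \<or> k = 3\<rbrakk> \<Longrightarrow>
       integral {0..2*pi} (\<lambda>t. f (cos t *\<^sub>R A + sin t *\<^sub>R B) * cos (real k * t)) = 0"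
    and onb: "orthonormal_triple p u v"
  obtains c a b where "\<And>s t. s\<^sup>2 + t\<^sup>2 = 1 \<Longrightarrow> f (s *\<^sub>R p + t *\<^sub>R u) = c + a * s + b * t"
proof -
  define L :: "real^3 \<Rightarrow> 'a" where "L x = (x $ 1) *\<^sub>R p + (x $ 2) *\<^sub>R u + (x $ 3) *\<^sub>R v" for x
  have inner_L: "L x \<bullet> L y = x \<bullet> y" for x y
    by (simp add: L_def inner_add_left inner_add_right orthonormal_triple_inner[OF onb] inner_vec_def sum_3)
  have norm_L: "norm (L x) = norm x" for x by (simp add: norm_eq_sqrt_inner inner_L)
  have lin_L: "L (s *\<^sub>R x + t *\<^sub>R y) = s *\<^sub>R L x + t *\<^sub>R L y" for s t x y
    by (simp add: L_def algebra_simps)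
  have "continuous_on (sphere 0 1) (\<lambda>x. f (L x))"
    by (rule continuous_on_compose2[OF f]) (auto simp: norm_L, auto simp: L_def intro!: continuous_intros)
  moreover have "integral {0..2*pi} (\<lambda>t. f (L (cos t *\<^sub>R A + sin t *\<^sub>R B)) * cos (real k * t)) = 0"
    if "norm A = 1" "norm B = 1" "A \<bullet> B = 0" "k = 2 \<or> k = 3" for A B k
    unfolding lin_L by (rule circ) (use that in \<open>auto simp: norm_L inner_L\<close>)
  ultimately obtain c a where ca: "\<And>x. norm x = 1 \<Longrightarrow> f (L x) = c + a \<bullet> x"
    by (rule affine_on_sphere_real3) blast+
  have "f (s *\<^sub>R p + t *\<^sub>R u) = c + (a $ 1) * s + (a $ 2) * t" if "s\<^sup>2 + t\<^sup>2 = 1" for s t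
  proof -
    define x :: "real^3" where "x = vector [s, t, 0]"
    have "norm x = 1" using that by (simp add: x_def norm_eq_1 inner_vec_def sum_3 power2_eq_square)
    from ca[OF this] show ?thesis by (simp add: x_def L_def inner_vec_def sum_3)
  qed
  then show ?thesis by (rule that)
qed

text \<open>Every point lies on a great circle through x0, so f x + f (-x) is the same for all x, and all
the affine functions share their constant term c. The homogeneous extension h of f - c
is linear on every plane, hence linear, because each sum involves only one plane.\<close>

lemma affine_if_affine_on_great_circles:
  fixes f :: "'a::euclidean_space \<Rightarrow> real"
  assumes dim: "DIM('a) \<ge> 3"
    and aff: "\<And>p u v::'a. orthonormal_triple p u v \<Longrightarrow>
      \<exists>c a b. \<forall>s t. s\<^sup>2 + t\<^sup>2 = 1 \<longrightarrow> f (s *\<^sub>R p + t *\<^sub>R u) = c + a * s + b * t"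
  shows "\<exists>c a. \<forall>x \<in> sphere 0 1. f x = c + a \<bullet> x"
proof -
  obtain x0 :: 'a where x0: "norm x0 = 1" using vector_choose_size[of 1] by auto
  define c where "c = (f x0 + f (- x0)) / 2"
  have even: "f x + f (- x) = 2 * c" if x: "norm x = 1" for x
  proof -
    obtain u v where onb: "orthonormal_triple x0 u v" and x_eq: "x = (x0 \<bullet> x) *\<^sub>R x0 + (u \<bullet> x) *\<^sub>R u"
      by (rule orthonormal_triple_extend[OF dim x0])
    obtain c' a b where aff': "\<And>s t. s\<^sup>2 + t\<^sup>2 = 1 \<Longrightarrow> f (s *\<^sub>R x0 + t *\<^sub>R u) = c' + a * s + b * t"
      using aff[OF onb] by blast
    have "x \<bullet> x = (x0 \<bullet> x)\<^sup>2 + (u \<bullet> x)\<^sup>2"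
      using arg_cong[OF x_eq, of "\<lambda>w. w \<bullet> x"] by (simp add: inner_add_left power2_eq_square)
    then have st: "(x0 \<bullet> x)\<^sup>2 + (u \<bullet> x)\<^sup>2 = 1" using x by (simp add: norm_eq_1)
    have "- x = (- (x0 \<bullet> x)) *\<^sub>R x0 + (- (u \<bullet> x)) *\<^sub>R u" using arg_cong[OF x_eq, of uminus] by simp
    then have "f x + f (- x) = 2 * c'"
      using aff'[OF st] aff'[of "- (x0 \<bullet> x)" "- (u \<bullet> x)"] st x_eq by simp
    moreover have "f x0 + f (- x0) = 2 * c'"
      using aff'[of 1 0] aff'[of "-1" 0] by simp
    ultimately show ?thesis by (simp add: c_def)
  qed
  define h where "h y = norm y * (f (y /\<^sub>R norm y) - c)" for y
  have lin_plane: "\<exists>a b. \<forall>s t. h (s *\<^sub>R p + t *\<^sub>R u) = a * s + b * t" if onb: "orthonormal_triple p u v" for p u v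
  proof -
    obtain c' a b where aff': "\<And>s t. s\<^sup>2 + t\<^sup>2 = 1 \<Longrightarrow> f (s *\<^sub>R p + t *\<^sub>R u) = c' + a * s + b * t"
      using aff[OF onb] by blast
    have "norm p = 1" using onb by (simp add: orthonormal_triple_def)
    with even[of p] aff'[of 1 0] aff'[of "-1" 0] have c': "c' = c" by simp
    have "h (s *\<^sub>R p + t *\<^sub>R u) = a * s + b * t" for s t
    proof -
      define n where "n = norm (s *\<^sub>R p + t *\<^sub>R u)"
      have "n\<^sup>2 = s\<^sup>2 + t\<^sup>2"
        unfolding n_def power2_norm_eq_inner
        by (simp add: inner_add_left inner_add_right orthonormal_triple_inner[OF onb] power2_eq_square)
      show ?thesis
      proof (cases "n = 0")
        case True
        then show ?thesis using \<open>n\<^sup>2 = s\<^sup>2 + t\<^sup>2\<close> by (simp add: h_def n_def sum_power2_eq_zero_iff)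
      next
        case False
        then have "(s/n)\<^sup>2 + (t/n)\<^sup>2 = 1" using \<open>n\<^sup>2 = s\<^sup>2 + t\<^sup>2\<close>
          by (metis add_divide_distrib divide_self_if power_divide zero_eq_power2)
        from aff'[OF this] have "f ((s *\<^sub>R p + t *\<^sub>R u) /\<^sub>R n) = c + a * (s/n) + b * (t/n)"
          by (simp add: c' scaleR_add_right divide_inverse mult.commute)
        then show ?thesis using False by (simp add: h_def flip: n_def) (simp add: field_simps)
      qed
    qed
    then show ?thesis by blast
  qed
  have "linear h"
  proof (rule linearI)
    have decomp: "\<exists>p u v r s t. orthonormal_triple p u v \<and> x = r *\<^sub>R p \<and> y = s *\<^sub>R p + t *\<^sub>R u" for x y :: 'a
    proof -
      obtain p where p: "norm p = 1" "x = norm x *\<^sub>R p"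
        using x0 by (cases "x = 0") (auto intro: that[of x0] that[of "x /\<^sub>R norm x"])
      then show ?thesis using orthonormal_triple_extend[OF dim p(1), of y] by metis
    qed
    fix x y :: 'a and k :: real
    obtain p u v r s t where onb: "orthonormal_triple p u v" and x: "x = r *\<^sub>R p" and y: "y = s *\<^sub>R p + t *\<^sub>R u"
      using decomp[of x y] by blast
    obtain a b where ab: "\<And>s t. h (s *\<^sub>R p + t *\<^sub>R u) = a * s + b * t"
      using lin_plane[OF onb] by blast
    have "x + y = (r + s) *\<^sub>R p + t *\<^sub>R u" by (simp add: x y algebra_simps)
    then show "h (x + y) = h x + h y" using ab[of "r+s" t] ab[of r 0] ab[of s t]
      by (simp add: x y algebra_simps)
    show "h (k *\<^sub>R x) = k *\<^sub>R h x" using ab[of "k*r" 0] ab[of r 0] by (simp add: x)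
  qed
  have "f x = c + adjoint h 1 \<bullet> x" if "norm x = 1" for x
    using adjoint_works[OF \<open>linear h\<close>, of x 1] that by (simp add: h_def inner_commute)
  then show ?thesis by (intro exI[of _ c] exI[of _ "adjoint h 1"]) auto
qed

section \<open>The exceptional angle\<close>

text \<open>On the unit circle a binary cubic form is the sum of the linear form with coefficients l, m and of a
combination of cos (3 t) and sin (3 t), which a rotation by 2 pi / 3 leaves invariant.\<close>

lemma binary_cubic_rotation_third:
  fixes A B C D c s r3 :: real
  assumes "c\<^sup>2 + s\<^sup>2 = 1" "r3\<^sup>2 = 3"
  defines "l \<equiv> (3*A + C) / 4" and "m \<equiv> (B + 3*D) / 4"
    and "c' \<equiv> - (1/2) * c - r3/2 * s" and "s' \<equiv> r3/2 * c - (1/2) * s"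
  shows "A * c'^3 + B * c'^2 * s' + C * c' * s'^2 + D * s'^3 - (l * c' + m * s')
       = A * c^3 + B * c^2 * s + C * c * s^2 + D * s^3 - (l * c + m * s)"
proof -
  define \<alpha> where "\<alpha> = (A - C) / 4"
  define \<beta> where "\<beta> = (B - D) / 4"
  have split: "A * x^3 + B * x^2 * y + C * x * y^2 + D * y^3 - (l * x + m * y)
      = \<alpha> * (x^3 - 3 * x * y^2) + \<beta> * (3 * x^2 * y - y^3)" if "x\<^sup>2 + y\<^sup>2 = 1" for x y
    using that unfolding l_def m_def \<alpha>_def \<beta>_def by algebra
  have double: "2 * c' = - c - r3 * s" "2 * s' = r3 * c - s" by (simp_all add: c'_def s'_def)
  have "4 * (c'\<^sup>2 + s'\<^sup>2) = 4 * 1" using assms(1,2) double by algebra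
  moreover have "c'^3 - 3 * c' * s'^2 = c^3 - 3 * c * s^2" "3 * c'^2 * s' - s'^3 = 3 * c^2 * s - s^3"
  proof -
    have rr: "r3 * (r3 * x) = 3 * x" for x using assms(2) by (simp add: power2_eq_square flip: mult.assoc)
    define x y where "x = 2 * c'" and "y = 2 * s'"
    have "8 * (c'^3 - 3 * c' * s'^2) = x^3 - 3 * x * y^2"
      "8 * (3 * c'^2 * s' - s'^3) = 3 * x^2 * y - y^3"
      by (simp_all add: x_def y_def power_mult_distrib)
    moreover have "x^3 - 3 * x * y^2 = 8 * (c^3 - 3 * c * s^2)"
      "3 * x^2 * y - y^3 = 8 * (3 * c^2 * s - s^3)"
      unfolding x_def y_def double by (simp_all add: power2_eq_square power3_eq_cube algebra_simps rr)
    ultimately have "8 * (c'^3 - 3 * c' * s'^2) = 8 * (c^3 - 3 * c * s^2)"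
      "8 * (3 * c'^2 * s' - s'^3) = 8 * (3 * c^2 * s - s^3)"
      by (simp_all only:)
    then show "c'^3 - 3 * c' * s'^2 = c^3 - 3 * c * s^2" "3 * c'^2 * s' - s'^3 = 3 * c^2 * s - s^3"
      by (simp_all only: mult_cancel_left) simp_all
  qed
  ultimately show ?thesis using split[of c' s'] split[OF assms(1)] by simp
qed

lemma product_of_three_linear_forms_rotation_third:
  fixes f :: "'a::euclidean_space \<Rightarrow> real"
  assumes f: "\<And>x. x \<in> sphere 0 1 \<Longrightarrow> f x = (e1 \<bullet> x) * (e2 \<bullet> x) * (e3 \<bullet> x)"
    and P: "subspace P" "dim P = 2"
  shows "\<exists>\<phi> b. rotation_of_plane P (2 * pi / 3) \<phi> \<and> b \<in> P \<and>
             (\<forall>x \<in> sphere 0 1 \<inter> P. f (\<phi> x) + b \<bullet> x = f x)"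
proof -
  obtain Bs where Bs: "Bs \<subseteq> P" "pairwise orthogonal Bs" "\<And>x. x \<in> Bs \<Longrightarrow> norm x = 1"
      "independent Bs" "card Bs = dim P" "span Bs = P"
    by (rule orthonormal_basis_subspace[OF P(1)]) blast
  from Bs(5) P(2) have "card Bs = 2" by simp
  then obtain u v where uv: "Bs = {u, v}" "u \<noteq> v" by (auto simp: card_2_iff)
  have span: "span {u,v} = P" using Bs uv by simp
  have inn: "u \<bullet> u = 1" "v \<bullet> v = 1" "u \<bullet> v = 0" "v \<bullet> u = 0"
    using Bs(2,3) uv by (auto simp: pairwise_def orthogonal_def norm_eq_1)
  define r3 where "r3 = sqrt (3::real)"
  have r3: "r3\<^sup>2 = 3" by (simp add: r3_def)
  have trig: "cos (2 * pi / 3) = - (1/2)" "sin (2 * pi / 3) = r3 / 2"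
    using cos_120 sin_120 by (simp_all add: r3_def)
  define \<phi> where "\<phi> x = (- (1/2) * (u \<bullet> x) - r3/2 * (v \<bullet> x)) *\<^sub>R u + (r3/2 * (u \<bullet> x) - (1/2) * (v \<bullet> x)) *\<^sub>R v" for x
  define A B C D where "A = (e1 \<bullet> u) * (e2 \<bullet> u) * (e3 \<bullet> u)"
    and "B = (e1 \<bullet> u) * (e2 \<bullet> u) * (e3 \<bullet> v) + (e1 \<bullet> u) * (e2 \<bullet> v) * (e3 \<bullet> u) + (e1 \<bullet> v) * (e2 \<bullet> u) * (e3 \<bullet> u)"
    and "C = (e1 \<bullet> u) * (e2 \<bullet> v) * (e3 \<bullet> v) + (e1 \<bullet> v) * (e2 \<bullet> u) * (e3 \<bullet> v) + (e1 \<bullet> v) * (e2 \<bullet> v) * (e3 \<bullet> u)"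
    and "D = (e1 \<bullet> v) * (e2 \<bullet> v) * (e3 \<bullet> v)"
  define l m where "l = (3*A + C) / 4" and "m = (B + 3*D) / 4"
  \<comment> \<open>b represents the linear part of f minus its composition with the rotation.\<close>
  define b where "b = (l + l/2 - m * r3/2) *\<^sub>R u + (m + m/2 + l * r3/2) *\<^sub>R v"
  have f_plane: "f (c *\<^sub>R u + s *\<^sub>R v) = A * c^3 + B * c^2 * s + C * c * s^2 + D * s^3" if "c\<^sup>2 + s\<^sup>2 = 1" for c s
  proof -
    have "norm (c *\<^sub>R u + s *\<^sub>R v) = 1"
      using that by (simp add: norm_eq_1 inner_add_left inner_add_right inn power2_eq_square)
    then show ?thesis unfolding A_def B_def C_def D_def
      by (subst f) (auto simp: inner_add_right power2_eq_square power3_eq_cube algebra_simps)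
  qed
  have "rotation_of_plane P (2 * pi / 3) \<phi>"
    unfolding rotation_of_plane_def trig
    by (rule exI[of _ u], rule exI[of _ v])
       (use Bs(3) uv span in \<open>auto simp: inn \<phi>_def inner_add_right\<close>)
  moreover have "b \<in> P" unfolding b_def span[symmetric] by (intro span_add span_scale span_base) auto
  moreover have "f (\<phi> x) + b \<bullet> x = f x" if x: "x \<in> sphere 0 1 \<inter> P" for x
  proof -
    from x span obtain c s where x_eq: "x = c *\<^sub>R u + s *\<^sub>R v"
      by (auto simp: span_breakdown_eq eq_diff_eq diff_eq_eq) (metis add.commute)
    have cs: "c\<^sup>2 + s\<^sup>2 = 1"
      using x by (simp add: x_eq norm_eq_1 inner_add_left inner_add_right inn power2_eq_square)
    define c' s' where "c' = - (1/2) * c - r3/2 * s" and "s' = r3/2 * c - (1/2) * s"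
    have double: "2 * c' = - c - r3 * s" "2 * s' = r3 * c - s" by (simp_all add: c'_def s'_def)
    have "4 * (c'\<^sup>2 + s'\<^sup>2) = 4 * 1" using cs r3 double by algebra
    then have "c'\<^sup>2 + s'\<^sup>2 = 1" by simp
    moreover have "\<phi> x = c' *\<^sub>R u + s' *\<^sub>R v" by (simp add: \<phi>_def x_eq c'_def s'_def inner_add_right inn)
    moreover have "b \<bullet> x = (l * c + m * s) - (l * c' + m * s')"
      by (simp add: b_def x_eq c'_def s'_def inner_add_right inner_add_left inn field_simps)
    ultimately show ?thesis
      using binary_cubic_rotation_third[OF cs r3, of A B C D, folded l_def m_def c'_def s'_def]
        f_plane[OF cs] f_plane[of c' s'] by (simp add: x_eq)
  qed
  ultimately show ?thesis by blast
qed

theorem theorem1p3: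
  assumes "CARD('n::finite) \<ge> 3"
  shows
    "(\<forall>f :: real ^ 'n \<Rightarrow> real.
        continuous_on (sphere 0 1) f \<longrightarrow>
        (\<forall>P. subspace P \<and> dim P = 2 \<longrightarrow>
           (\<exists>q::nat. q \<ge> 4 \<and>
             (\<exists>\<phi> b. rotation_of_plane P (2 * pi / real q) \<phi> \<and> b \<in> P \<and>
               (\<forall>x \<in> sphere 0 1 \<inter> P. f (\<phi> x) + b \<bullet> x = f x)))) \<longrightarrow>
        (\<exists>c a. \<forall>x \<in> sphere 0 1. f x = c + a \<bullet> x)) \<and>
     (\<forall>(e :: nat \<Rightarrow> real ^ 'n) f.
        orthonormal_basis e \<longrightarrow>
        (\<forall>x \<in> sphere 0 1. f x = (e 1 \<bullet> x) * (e 2 \<bullet> x) * (e 3 \<bullet> x)) \<longrightarrow>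
        (\<forall>P. subspace P \<and> dim P = 2 \<longrightarrow>
           (\<exists>\<phi> b. rotation_of_plane P (2 * pi / 3) \<phi> \<and> b \<in> P \<and>
             (\<forall>x \<in> sphere 0 1 \<inter> P. f (\<phi> x) + b \<bullet> x = f x))))"
proof (intro conjI allI impI)
  fix f :: "real ^ 'n \<Rightarrow> real"
  assume f: "continuous_on (sphere 0 1) f"
    and rot: "\<forall>P. subspace P \<and> dim P = 2 \<longrightarrow>
           (\<exists>q::nat. q \<ge> 4 \<and>
             (\<exists>\<phi> b. rotation_of_plane P (2 * pi / real q) \<phi> \<and> b \<in> P \<and>
               (\<forall>x \<in> sphere 0 1 \<inter> P. f (\<phi> x) + b \<bullet> x = f x)))"
  have circ: "integral {0..2*pi} (\<lambda>t. f (cos t *\<^sub>R A + sin t *\<^sub>R B) * cos (real k * t)) = 0"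
    if "norm A = 1" "norm B = 1" "A \<bullet> B = 0" "k = 2 \<or> k = 3" for A B k
    by (rule great_circle_Fourier_coeff_eq_0[OF f _ that]) (use rot in blast)
  show "\<exists>c a. \<forall>x \<in> sphere 0 1. f x = c + a \<bullet> x"
  proof (rule affine_if_affine_on_great_circles)
    show "DIM(real ^ 'n) \<ge> 3" using assms by simp
    show "\<exists>c a b. \<forall>s t. s\<^sup>2 + t\<^sup>2 = 1 \<longrightarrow> f (s *\<^sub>R p + t *\<^sub>R u) = c + a * s + b * t"
      if "orthonormal_triple p u v" for p u v
    proof (rule affine_on_great_circle[OF f _ that])
      fix c a b
      assume "\<And>s t. s\<^sup>2 + t\<^sup>2 = 1 \<Longrightarrow> f (s *\<^sub>R p + t *\<^sub>R u) = c + a * s + b * t"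
      then show ?thesis by blast
    qed (rule circ)
  qed
next
  fix e :: "nat \<Rightarrow> real ^ 'n" and f :: "real ^ 'n \<Rightarrow> real" and P :: "(real ^ 'n) set"
  assume "\<forall>x \<in> sphere 0 1. f x = (e 1 \<bullet> x) * (e 2 \<bullet> x) * (e 3 \<bullet> x)" "subspace P \<and> dim P = 2"
  then show "\<exists>\<phi> b. rotation_of_plane P (2 * pi / 3) \<phi> \<and> b \<in> P \<and>
             (\<forall>x \<in> sphere 0 1 \<inter> P. f (\<phi> x) + b \<bullet> x = f x)"
    by (intro product_of_three_linear_forms_rotation_third) auto
qed

end
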